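(* Let $1<q\le p<\infty$ and $A\subset\overline\Omega$. If $\mathrm{Cap}_{p,\Omega}(A)=0$, then $\mathrm{Cap}_{q,\Omega}(A)=0$.
   Context: $\Omega\subset\mathbb{R}^N$ is a nonempty open set. For $r\in(1,\infty)$: $W^{1,r}(\Omega)$ is the usual Sobolev space with norm $\|u\|^r_{W^{1,r}(\Omega)}=\int_\Omega |u|^r+|\nabla u|^r\,dx$; $\tilde W^{1,r}(\Omega)$ is the closure in $W^{1,r}(\Omega)$ of $\{u|_\Omega: u\in C_c(\overline\Omega),\ u|_\Omega\in W^{1,r}(\Omega)\}$; for $A\subset\overline\Omega$, $\mathcal{Y}_{r,\Omega}(A)=\{u\in\tilde W^{1,r}(\Omega):\ \exists\, O \text{ open in } \overline\Omega \text{ (relative topology) with } A\subset O,\ u\ge 1 \text{ a.e. on } O\cap\Omega\}$ and $\mathrm{Cap}_{r,\Omega}(A)=\inf\{\|u\|^r_{W^{1,r}(\Omega)}: u\in\mathcal{Y}_{r,\Omega}(A)\}$ ($\inf\emptyset=\infty$). *)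

theory Defs
  imports "HOL-Analysis.Analysis"
begin

fun iter_pderiv :: "'a::euclidean_space list \<Rightarrow> ('a \<Rightarrow> real) \<Rightarrow> 'a \<Rightarrow> real" where
  "iter_pderiv [] f = f"
| "iter_pderiv (v # vs) f = (\<lambda>x. frechet_derivative (iter_pderiv vs f) (at x) v)"

definition smooth_fun :: "('a::euclidean_space \<Rightarrow> real) \<Rightarrow> bool" where
  "smooth_fun f \<longleftrightarrow> (\<forall>vs. set vs \<subseteq> Basis \<longrightarrow> (\<forall>x. iter_pderiv vs f differentiable (at x)))"

definition test_fun :: "'a::euclidean_space set \<Rightarrow> ('a \<Rightarrow> real) \<Rightarrow> bool" where
  "test_fun \<Omega> \<phi> \<longleftrightarrow> smooth_fun \<phi> \<and> compact (closure {x. \<phi> x \<noteq> 0})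
      \<and> closure {x. \<phi> x \<noteq> 0} \<subseteq> \<Omega>"

definition weak_grad :: "'a::euclidean_space set \<Rightarrow> ('a \<Rightarrow> real) \<Rightarrow> ('a \<Rightarrow> 'a) \<Rightarrow> bool" where
  "weak_grad \<Omega> u g \<longleftrightarrow> (\<forall>\<phi>. test_fun \<Omega> \<phi> \<longrightarrow> (\<forall>i\<in>Basis.
      set_integrable lebesgue \<Omega> (\<lambda>x. u x * frechet_derivative \<phi> (at x) i) \<and>
      set_integrable lebesgue \<Omega> (\<lambda>x. (g x \<bullet> i) * \<phi> x) \<and>
      (LINT x:\<Omega>|lebesgue. u x * frechet_derivative \<phi> (at x) i)
        = - (LINT x:\<Omega>|lebesgue. (g x \<bullet> i) * \<phi> x)))"

definition Lr_int :: "real \<Rightarrow> 'a::euclidean_space set \<Rightarrow> ('a \<Rightarrow> 'b::real_normed_vector) \<Rightarrow> ennreal" where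
  "Lr_int r \<Omega> f = (\<integral>\<^sup>+ x. indicator \<Omega> x * ennreal (norm (f x) powr r) \<partial>lebesgue)"

definition in_Lr :: "real \<Rightarrow> 'a::euclidean_space set \<Rightarrow> ('a \<Rightarrow> 'b::{real_normed_vector, second_countable_topology}) \<Rightarrow> bool" where
  "in_Lr r \<Omega> f \<longleftrightarrow> (\<lambda>x. indicator \<Omega> x *\<^sub>R f x) \<in> borel_measurable lebesgue \<and> Lr_int r \<Omega> f < \<infinity>"

definition W1 :: "real \<Rightarrow> 'a::euclidean_space set \<Rightarrow> ('a \<Rightarrow> real) set" where
  "W1 r \<Omega> = {u. in_Lr r \<Omega> u \<and> (\<exists>g. in_Lr r \<Omega> g \<and> weak_grad \<Omega> u g)}"

definition wgrad :: "real \<Rightarrow> 'a::euclidean_space set \<Rightarrow> ('a \<Rightarrow> real) \<Rightarrow> ('a \<Rightarrow> 'a)" where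
  "wgrad r \<Omega> u = (SOME g. in_Lr r \<Omega> g \<and> weak_grad \<Omega> u g)"

definition W1_normr :: "real \<Rightarrow> 'a::euclidean_space set \<Rightarrow> ('a \<Rightarrow> real) \<Rightarrow> ennreal" where
  "W1_normr r \<Omega> u = (\<integral>\<^sup>+ x. indicator \<Omega> x *
      ennreal (\<bar>u x\<bar> powr r + norm (wgrad r \<Omega> u x) powr r) \<partial>lebesgue)"

text \<open>Restrictions to Omega of functions in C_c(closure Omega) lying in W^{1,r}(Omega).
  Functions on Omega are represented by functions on the whole space; only values on Omega matter.\<close>
definition Cc_closure_W1 :: "real \<Rightarrow> 'a::euclidean_space set \<Rightarrow> ('a \<Rightarrow> real) set" where
  "Cc_closure_W1 r \<Omega> = {u. continuous_on (closure \<Omega>) u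
      \<and> compact (closure {x \<in> closure \<Omega>. u x \<noteq> 0}) \<and> u \<in> W1 r \<Omega>}"

definition W1_tilde :: "real \<Rightarrow> 'a::euclidean_space set \<Rightarrow> ('a \<Rightarrow> real) set" where
  "W1_tilde r \<Omega> = {u \<in> W1 r \<Omega>. \<exists>v. (\<forall>n. v n \<in> Cc_closure_W1 r \<Omega>)
      \<and> (\<lambda>n. W1_normr r \<Omega> (\<lambda>x. v n x - u x)) \<longlonglongrightarrow> 0}"

definition Y_set :: "real \<Rightarrow> 'a::euclidean_space set \<Rightarrow> 'a set \<Rightarrow> ('a \<Rightarrow> real) set" where
  "Y_set r \<Omega> A = {u \<in> W1_tilde r \<Omega>. \<exists>U. openin (top_of_set (closure \<Omega>)) U \<and> A \<subseteq> U
      \<and> (AE x in lebesgue. x \<in> U \<inter> \<Omega> \<longrightarrow> 1 \<le> u x)}"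

definition Cap :: "real \<Rightarrow> 'a::euclidean_space set \<Rightarrow> 'a set \<Rightarrow> ennreal" where
  "Cap r \<Omega> A = (INF u \<in> Y_set r \<Omega> A. W1_normr r \<Omega> u)"

end

theory Submission
  imports Defs
begin

text \<open>Take smooth bumps \<open>\<eta>\<^sub>k \<ge> 0\<close>, supported in the bounded shells \<open>\<bar>k - x \<bullet> x\<bar> \<le> 1\<close>, whose sum is
  everywhere at least 1. On a bounded set smallness in \<open>W\<^sup>1\<^sup>,\<^sup>p\<close> forces smallness in \<open>W\<^sup>1\<^sup>,\<^sup>q\<close>, so
  admissible functions \<open>u\<^sub>k\<close> for \<open>Cap p\<close> of very small norm make \<open>\<Sum>k. \<eta>\<^sub>k u\<^sub>k\<close> small in
  \<open>W\<^sup>1\<^sup>,\<^sup>q\<close>. The sum is locally finite, so near each point of \<open>A\<close> only finitely many of the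
  neighbourhoods on which \<open>u\<^sub>k \<ge> 1\<close> have to be intersected, and there the sum is at least 1. This
  avoids truncations, hence any chain rule for weak gradients. Because the norm is
  defined through a chosen weak gradient, uniqueness of weak gradients is needed as well; it is the
  fundamental lemma of the calculus of variations, tested with bumps converging to indicators of boxes.\<close>

text \<open>The obstacle is that \<Omega> may have infinite measure: for q < p a function of small
  p-norm may then have infinite q-norm, so one admissible function is not enough. The constants lost
  on shell k (bounds for the bump and its gradient, the measure of the shell) may grow with k in any
  way, because they are fixed before u k is chosen and zero capacity supplies arbitrarily small
  p-norms. Shells are cut out by x . x and not by the norm because x . x is a polynomial, so the
  bumps are smooth at the origin too. The remaining difficulty is that the glued function must lie
  in \<open>W1_tilde q\<close>, where approximants need compact support. Hence only the u k with k
  \<le> n are replaced by approximants and all later ones by 0; the error of the omitted tail is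
  controlled by the smallness of the u k themselves.\<close>

section \<open>Smooth bump functions\<close>

text \<open>The exponent \<open>n\<close> makes this family of one-sided smooth functions closed, up to linear
  combinations, under differentiation.\<close>

definition flat :: "nat \<Rightarrow> real \<Rightarrow> real" where
  "flat n t = (if t > 0 then exp (- inverse t) * inverse t ^ n else 0)"

lemma flat_nonneg: "0 \<le> flat n t"
  by (simp add: flat_def)

lemma flat_0_less_1: "flat 0 t < 1"
  by (simp add: flat_def)

text \<open>Substituting s = 1/t turns this into the decay of s^n / exp s at infinity.\<close>

lemma flat_tendsto_0: "(flat n \<longlongrightarrow> 0) (at_right 0)"
proof -
  have "((\<lambda>t. inverse t ^ n / exp (inverse t :: real)) \<longlongrightarrow> 0) (at_right 0)"
    by (rule filterlim_compose[OF tendsto_power_div_exp_0 filterlim_inverse_at_top_right])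
  moreover have "\<forall>\<^sub>F t in at_right 0. flat n t = inverse t ^ n / exp (inverse t)"
    by (auto simp: flat_def exp_minus divide_inverse mult.commute eventually_at_right_less eventually_at_filter)
  ultimately show ?thesis
    by (simp cong: filterlim_cong)
qed

lemma DERIV_flat:
  "(flat n has_real_derivative flat (n + 2) t - real n * flat (n + 1) t) (at t)"
proof -
  consider "t > 0" | "t < 0" | "t = 0" by linarith
  then show ?thesis
  proof cases
    case 1
    have inv: "((\<lambda>t. inverse t) has_real_derivative - (inverse t)\<^sup>2) (at t)"
      using 1 by (auto intro!: derivative_eq_intros simp: power2_eq_square)
    have pow: "((\<lambda>t. inverse t ^ n) has_real_derivative - real n * inverse t ^ (n + 1)) (at t)"
      using DERIV_power[OF inv, of n] by (cases n) (simp_all add: power2_eq_square algebra_simps)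
    have "((\<lambda>t. exp (- inverse t)) has_real_derivative exp (- inverse t) * (inverse t)\<^sup>2) (at t)"
      using 1 by (auto intro!: derivative_eq_intros simp: power2_eq_square)
    from DERIV_mult[OF this pow]
    have "((\<lambda>t. exp (- inverse t) * inverse t ^ n) has_real_derivative
        flat (n + 2) t - real n * flat (n + 1) t) (at t)"
      using 1 by (simp add: flat_def power2_eq_square algebra_simps)
    then show ?thesis
      by (rule has_field_derivative_transform_within_open[where S="{0<..}"])
         (use 1 in \<open>auto simp: flat_def\<close>)
  next
    case 2
    have "((\<lambda>t. 0) has_real_derivative flat (n + 2) t - real n * flat (n + 1) t) (at t)"
      using 2 by (simp add: flat_def)
    then show ?thesis
      by (rule has_field_derivative_transform_within_open[where S="{..<0}"])
         (use 2 in \<open>auto simp: flat_def\<close>)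
  next
    case 3
    have "((\<lambda>h. flat n h / h) \<longlongrightarrow> 0) (at_left 0)"
      by (rule tendsto_eventually) (auto simp: flat_def eventually_at_filter)
    moreover have "((\<lambda>h. flat n h / h) \<longlongrightarrow> 0) (at_right 0)"
    proof -
      \<comment> \<open>Dividing by h only raises the exponent by one, so the right difference
        quotient at 0 is again a member of the family.\<close>
      have "\<forall>\<^sub>F h in at_right 0. flat n h / h = flat (Suc n) h"
        by (auto simp: flat_def eventually_at_filter divide_inverse)
      then show ?thesis
        using flat_tendsto_0[of "Suc n"] by (simp cong: filterlim_cong)
    qed
    ultimately have "((\<lambda>h. flat n h / h) \<longlongrightarrow> 0) (at 0)"
      by (simp add: filterlim_at_split)
    with 3 show ?thesis
      by (simp add: DERIV_def flat_def)
  qed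
qed

section \<open>Closure properties of smooth functions\<close>

lemma frechet_derivative_eq:
  "(f has_derivative f') (at x) \<Longrightarrow> frechet_derivative f (at x) = f'"
  by (rule frechet_derivative_at[symmetric])

lemma iter_pderiv_append: "iter_pderiv (vs @ ws) f = iter_pderiv vs (iter_pderiv ws f)"
  by (induction vs) auto

lemma smooth_fun_differentiable: "smooth_fun f \<Longrightarrow> f differentiable (at x)"
  unfolding smooth_fun_def by (metis empty_subsetI iter_pderiv.simps(1) list.set(1))

lemma smooth_fun_pderiv:
  assumes "smooth_fun f" "i \<in> Basis"
  shows "smooth_fun (\<lambda>x. frechet_derivative f (at x) i)"
  unfolding smooth_fun_def
proof (intro allI impI)
  fix vs :: "'a list" and x assume "set vs \<subseteq> Basis"
  then have "iter_pderiv (vs @ [i]) f differentiable (at x)"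
    using assms unfolding smooth_fun_def by (metis insert_subset empty_subsetI list.simps(15) list.set(1) set_append le_supI)
  then show "iter_pderiv vs (\<lambda>x. frechet_derivative f (at x) i) differentiable at x"
    by (simp add: iter_pderiv_append)
qed

text \<open>Stable under partial derivatives, so it contains nothing but smooth functions; this is how
  the stability of smoothness under products and under composition with \<open>flat\<close> is obtained.\<close>

inductive smooth_alg :: "('a::euclidean_space \<Rightarrow> real) \<Rightarrow> bool" where
  base: "smooth_fun f \<Longrightarrow> smooth_alg f"
| const: "smooth_alg (\<lambda>x. c)"
| inner: "smooth_alg (\<lambda>x. x \<bullet> v)"
| add: "smooth_alg f \<Longrightarrow> smooth_alg g \<Longrightarrow> smooth_alg (\<lambda>x. f x + g x)"
| mult: "smooth_alg f \<Longrightarrow> smooth_alg g \<Longrightarrow> smooth_alg (\<lambda>x. f x * g x)"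
| flat: "smooth_alg f \<Longrightarrow> smooth_alg (\<lambda>x. flat n (f x))"

text \<open>Each generator has derivatives expressible by generators; for \<open>flat\<close> this
  is the chain rule with \<open>DERIV_flat\<close>. Membership is tracked only in Basis directions,
  the ones that occur in \<open>smooth_fun\<close>.\<close>

lemma smooth_alg_deriv:
  assumes "smooth_alg f"
  shows "\<exists>f'. (\<forall>x. (f has_derivative f' x) (at x)) \<and> (\<forall>i\<in>Basis. smooth_alg (\<lambda>x. f' x i))"
  using assms
proof induction
  case (base f)
  then show ?case
    by (intro exI[of _ "\<lambda>x. frechet_derivative f (at x)"])
       (auto intro: smooth_alg.base smooth_fun_pderiv
          simp: smooth_fun_differentiable frechet_derivative_works[symmetric])
next
  case (const c)
  show ?case
    by (intro exI[of _ "\<lambda>x v. 0"]) (auto intro: smooth_alg.const)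
next
  case (inner v)
  show ?case
    by (intro exI[of _ "\<lambda>x w. w \<bullet> v"]) (auto intro!: smooth_alg.const derivative_eq_intros)
next
  case (add f g)
  then obtain f' g' where
    "\<forall>x. (f has_derivative f' x) (at x)" "\<forall>i\<in>Basis. smooth_alg (\<lambda>x. f' x i)"
    "\<forall>x. (g has_derivative g' x) (at x)" "\<forall>i\<in>Basis. smooth_alg (\<lambda>x. g' x i)"
    by auto
  then show ?case
    by (intro exI[of _ "\<lambda>x v. f' x v + g' x v"]) (auto intro: smooth_alg.add has_derivative_add)
next
  case (mult f g)
  then obtain f' g' where
    "\<forall>x. (f has_derivative f' x) (at x)" "\<forall>i\<in>Basis. smooth_alg (\<lambda>x. f' x i)"
    "\<forall>x. (g has_derivative g' x) (at x)" "\<forall>i\<in>Basis. smooth_alg (\<lambda>x. g' x i)"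
    by auto
  then show ?case
    using mult.hyps
    by (intro exI[of _ "\<lambda>x v. f x * g' x v + f' x v * g x"])
       (auto intro!: smooth_alg.add smooth_alg.mult has_derivative_mult)
next
  case (flat f n)
  then obtain f' where f':
    "\<And>x. (f has_derivative f' x) (at x)" "\<forall>i\<in>Basis. smooth_alg (\<lambda>x. f' x i)"
    by auto
  show ?case
  proof (intro exI[of _ "\<lambda>x v. f' x v * (flat (n + 2) (f x) + (- real n) * flat (n + 1) (f x))"] conjI allI ballI)
    fix x
    show "((\<lambda>x. flat n (f x)) has_derivative
        (\<lambda>v. f' x v * (flat (n + 2) (f x) + (- real n) * flat (n + 1) (f x)))) (at x)"
      using DERIV_compose_FDERIV[OF DERIV_flat f'(1)] by simp
  next
    fix i :: 'a assume "i \<in> Basis"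
    then show "smooth_alg (\<lambda>x. f' x i * (flat (n + 2) (f x) + (- real n) * flat (n + 1) (f x)))"
      using f'(2) flat.hyps
      by (intro smooth_alg.add smooth_alg.mult smooth_alg.const smooth_alg.flat) auto
  qed
qed

text \<open>The induction over the list of directions carries membership in the algebra;
  differentiability alone would say nothing about the next derivative.\<close>

lemma smooth_alg_imp_smooth_fun:
  assumes "smooth_alg f"
  shows "smooth_fun f"
proof -
  have *: "smooth_alg (iter_pderiv vs f)" if "set vs \<subseteq> Basis" for vs
    using that
  proof (induction vs)
    case Nil
    then show ?case using assms by simp
  next
    case (Cons i vs)
    then obtain f' where "\<And>x. (iter_pderiv vs f has_derivative f' x) (at x)"
        "\<forall>i\<in>Basis. smooth_alg (\<lambda>x. f' x i)"
      using smooth_alg_deriv[of "iter_pderiv vs f"] by auto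
    moreover from this have "frechet_derivative (iter_pderiv vs f) (at x) = f' x" for x
      by (simp add: frechet_derivative_eq)
    ultimately show ?case
      using Cons.prems by simp
  qed
  show ?thesis
    unfolding smooth_fun_def using smooth_alg_deriv[OF *] by (meson differentiableI)
qed

lemma smooth_fun_const: "smooth_fun (\<lambda>x. c)"
  and smooth_fun_inner: "smooth_fun (\<lambda>x. x \<bullet> v)"
  by (simp_all add: smooth_alg_imp_smooth_fun smooth_alg.const smooth_alg.inner)

lemma smooth_fun_add: "smooth_fun f \<Longrightarrow> smooth_fun g \<Longrightarrow> smooth_fun (\<lambda>x. f x + g x)"
  and smooth_fun_mult: "smooth_fun f \<Longrightarrow> smooth_fun g \<Longrightarrow> smooth_fun (\<lambda>x. f x * g x)"
  and smooth_fun_flat: "smooth_fun f \<Longrightarrow> smooth_fun (\<lambda>x. flat n (f x))"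
  by (simp_all add: smooth_alg_imp_smooth_fun smooth_alg.base smooth_alg.add smooth_alg.mult
        smooth_alg.flat)

lemma smooth_fun_prod:
  "(\<And>i. i \<in> I \<Longrightarrow> smooth_fun (f i)) \<Longrightarrow> smooth_fun (\<lambda>x. \<Prod>i\<in>I. f i x)"
  by (induction I rule: infinite_finite_induct) (auto intro: smooth_fun_const smooth_fun_mult)

lemma smooth_fun_sum:
  "(\<And>i. i \<in> I \<Longrightarrow> smooth_fun (f i)) \<Longrightarrow> smooth_fun (\<lambda>x. \<Sum>i\<in>I. f i x)"
  by (induction I rule: infinite_finite_induct) (auto intro: smooth_fun_const smooth_fun_add)

lemma smooth_fun_norm_sq: "smooth_fun (\<lambda>x. x \<bullet> x)"
  by (subst euclidean_inner) (intro smooth_fun_sum smooth_fun_mult smooth_fun_inner)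

lemma smooth_fun_continuous_on: "smooth_fun f \<Longrightarrow> continuous_on S f"
  by (meson continuous_at_imp_continuous_on differentiable_imp_continuous_within smooth_fun_differentiable)

lemma smooth_fun_measurable: "smooth_fun f \<Longrightarrow> f \<in> borel_measurable lebesgue"
  by (simp add: borel_measurable_continuous_onI measurable_completion smooth_fun_continuous_on)

lemma smooth_fun_has_derivative:
  "smooth_fun f \<Longrightarrow> (f has_derivative frechet_derivative f (at x)) (at x)"
  by (simp add: smooth_fun_differentiable frechet_derivative_works[symmetric])

lemma frechet_derivative_outside_support:
  assumes "x \<notin> closure {x. f x \<noteq> 0}"
  shows "frechet_derivative f (at x) = (\<lambda>v. 0)"
proof -
  have "((\<lambda>x. 0) has_derivative (\<lambda>v. 0)) (at x)" by simp
  then have "(f has_derivative (\<lambda>v. 0)) (at x)"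
    by (rule has_derivative_transform_within_open[where s="- closure {x. f x \<noteq> 0}"])
       (use assms closure_subset[of "{x. f x \<noteq> 0}"] in auto)
  then show ?thesis by (rule frechet_derivative_eq)
qed

lemma test_fun_mult_smooth:
  assumes "smooth_fun \<eta>" "test_fun \<Omega> \<phi>"
  shows "test_fun \<Omega> (\<lambda>x. \<eta> x * \<phi> x)"
proof -
  have *: "closure {x. \<eta> x * \<phi> x \<noteq> 0} \<subseteq> closure {x. \<phi> x \<noteq> 0}"
    by (rule closure_mono) auto
  then have "compact (closure {x. \<eta> x * \<phi> x \<noteq> 0})"
    using assms(2) unfolding test_fun_def by (metis bounded_subset closed_closure compact_eq_bounded_closed)
  with * assms show ?thesis
    unfolding test_fun_def by (auto intro: smooth_fun_mult)
qed

lemma bounded_range_of_compact_support: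
  fixes f :: "'a::euclidean_space \<Rightarrow> 'b::real_normed_vector"
  assumes "continuous_on UNIV f" "compact K" "\<And>x. x \<notin> K \<Longrightarrow> f x = 0"
  obtains M where "M > 0" "\<And>x. norm (f x) \<le> M"
proof -
  have "bounded (f ` K)"
    using assms by (meson compact_continuous_image compact_imp_bounded continuous_on_subset subset_UNIV)
  then obtain M where M: "M > 0" "\<And>x. x \<in> K \<Longrightarrow> norm (f x) \<le> M"
    by (auto simp: bounded_pos)
  have "norm (f x) \<le> M" for x
    using M assms(3) by (cases "x \<in> K") (auto simp: less_imp_le)
  with M(1) show ?thesis by (rule that)
qed

section \<open>Smooth approximations of indicators of boxes\<close>

definition box_bump :: "'a::euclidean_space \<Rightarrow> 'a \<Rightarrow> nat \<Rightarrow> 'a \<Rightarrow> real" where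
  "box_bump a b n x =
    (\<Prod>i\<in>Basis. flat 0 (real (Suc n) * (x \<bullet> i - a \<bullet> i)) * flat 0 (real (Suc n) * (b \<bullet> i - x \<bullet> i)))"

lemma box_bump_bounds: "0 \<le> box_bump a b n x" "box_bump a b n x \<le> 1"
  unfolding box_bump_def
  by (auto intro!: prod_nonneg prod_le_1 mult_nonneg_nonneg mult_le_one flat_nonneg less_imp_le[OF flat_0_less_1])

lemma flat_eq_0_iff: "flat n t = 0 \<longleftrightarrow> t \<le> 0"
  by (auto simp: flat_def)

lemma box_bump_eq_0_iff: "box_bump a b n x = 0 \<longleftrightarrow> x \<notin> box a b"
  by (auto simp: box_bump_def flat_eq_0_iff mem_box mult_le_0_iff not_less not_le)

lemma flat_0_scaled_tendsto_1:
  assumes "t > 0"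
  shows "(\<lambda>n. flat 0 (real (Suc n) * t)) \<longlonglongrightarrow> 1"
proof -
  have "(\<lambda>n. exp (- (inverse (real (Suc n)) * inverse t))) \<longlonglongrightarrow> exp (- (0 * inverse t))"
    by (intro tendsto_intros LIMSEQ_inverse_real_of_nat)
  then show ?thesis using assms by (simp add: flat_def inverse_mult_distrib)
qed

text \<open>The scale Suc n pushes each factor to 1 wherever its argument is positive and leaves its
  zero set unchanged. All approximants thus share the support of the limit, and no box has to be
  shrunk.\<close>

lemma box_bump_tendsto: "(\<lambda>n. box_bump a b n x) \<longlonglongrightarrow> indicator (box a b) x"
proof (cases "x \<in> box a b")
  case True
  have "(\<lambda>n. box_bump a b n x) \<longlonglongrightarrow> (\<Prod>i\<in>(Basis::'a set). 1 * 1)"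
    unfolding box_bump_def
    by (intro tendsto_prod tendsto_mult flat_0_scaled_tendsto_1) (use True in \<open>auto simp: mem_box\<close>)
  then show ?thesis using True by simp
next
  case False
  then have "box_bump a b n x = 0" for n by (simp add: box_bump_eq_0_iff)
  then show ?thesis using False by simp
qed

lemma smooth_fun_affine: "smooth_fun (\<lambda>x. c * (x \<bullet> v) + d)"
  by (intro smooth_fun_add smooth_fun_mult smooth_fun_const smooth_fun_inner)

lemma test_fun_box_bump:
  assumes "cbox a b \<subseteq> \<Omega>"
  shows "test_fun \<Omega> (box_bump a b n)"
proof -
  have "smooth_fun (\<lambda>x. \<Prod>i\<in>Basis. flat 0 (real (Suc n) * (x \<bullet> i) + (- real (Suc n) * (a \<bullet> i))) *
      flat 0 ((- real (Suc n)) * (x \<bullet> i) + real (Suc n) * (b \<bullet> i)))"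
    by (intro smooth_fun_prod smooth_fun_mult smooth_fun_flat smooth_fun_affine)
  then have "smooth_fun (box_bump a b n)"
    by (simp add: box_bump_def[abs_def] algebra_simps)
  moreover have "{x. box_bump a b n x \<noteq> 0} = box a b"
    by (simp add: box_bump_eq_0_iff)
  moreover have "closure (box a b) \<subseteq> cbox a b"
    by (rule closure_minimal) (auto simp: mem_box less_imp_le)
  ultimately show ?thesis
    using assms bounded_box[of a b] by (auto simp: test_fun_def compact_closure)
qed

text \<open>The factor \<open>exp 4\<close> makes the bump at least 1 where \<open>x \<bullet> x\<close> is within 1/2 of \<open>k\<close>.\<close>

definition shell_bump :: "nat \<Rightarrow> 'a::euclidean_space \<Rightarrow> real" where
  "shell_bump k x = exp 4 * (flat 0 (x \<bullet> x - real k + 1) * flat 0 (real k + 1 - x \<bullet> x))"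

lemma shell_bump_nonneg: "0 \<le> shell_bump k x"
  by (simp add: shell_bump_def flat_nonneg)

lemma shell_bump_neq_0D: "shell_bump k x \<noteq> 0 \<Longrightarrow> \<bar>real k - x \<bullet> x\<bar> < 1"
  by (auto simp: shell_bump_def flat_eq_0_iff)

lemma flat_0_ge: "t \<ge> 1/2 \<Longrightarrow> exp (-2) \<le> flat 0 t"
  using le_imp_inverse_le[of "1/2" t] by (simp add: flat_def)

text \<open>Both arguments of \<open>flat 0\<close> are at least 1/2, so each factor is at least exp
  (-2); the constant exp 4 cancels exactly this loss.\<close>

lemma shell_bump_ge_1:
  assumes "\<bar>real k - x \<bullet> x\<bar> \<le> 1/2"
  shows "1 \<le> shell_bump k x"
proof -
  have "exp (-2) * exp (-2) \<le> flat 0 (x \<bullet> x - real k + 1) * flat 0 (real k + 1 - x \<bullet> x)"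
    using abs_le_D1[OF assms] abs_le_D2[OF assms]
    by (intro mult_mono flat_0_ge flat_nonneg) (linarith | simp)+
  then have "exp 4 * (exp (-2) * exp (-2)) \<le> shell_bump k x"
    unfolding shell_bump_def by (intro mult_left_mono) auto
  then show ?thesis by (simp flip: exp_add)
qed

lemma smooth_fun_shell_bump: "smooth_fun (shell_bump k)"
proof -
  have "smooth_fun (\<lambda>x::'a. exp 4 * (flat 0 (x \<bullet> x + (1 - real k)) * flat 0 ((real k + 1) + (- 1) * (x \<bullet> x))))"
    by (intro smooth_fun_mult smooth_fun_flat smooth_fun_add smooth_fun_const smooth_fun_norm_sq)
  then show ?thesis by (simp add: shell_bump_def[abs_def] algebra_simps)
qed

text \<open>The weak inequality makes the shell closed, so it contains the closed support of the
  bump, and the gradient of the bump vanishes off it as well.\<close>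

definition shell :: "nat \<Rightarrow> 'a::euclidean_space set" where
  "shell k = {x. \<bar>real k - x \<bullet> x\<bar> \<le> 1}"

lemma compact_shell: "compact (shell k)"
proof -
  have "shell k \<subseteq> cball 0 (sqrt (real k + 1))"
    by (auto simp: shell_def norm_eq_sqrt_inner)
  then have "bounded (shell k)" by (rule bounded_subset[OF bounded_cball])
  moreover have "closed (shell k)"
    unfolding shell_def by (intro closed_Collect_le continuous_intros)
  ultimately show ?thesis by (simp add: compact_eq_bounded_closed)
qed

lemma closure_shell_bump: "closure {x. shell_bump k x \<noteq> 0} \<subseteq> shell k"
proof (rule closure_minimal)
  show "{x. shell_bump k x \<noteq> 0} \<subseteq> shell k"
    by (auto dest: shell_bump_neq_0D simp: shell_def)
qed (rule compact_imp_closed[OF compact_shell])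

section \<open>Uniqueness of weak gradients\<close>

text \<open>Open boxes form an intersection-stable generator of the Borel sets, so a Dynkin argument
  extends vanishing integrals from boxes to all Borel sets.\<close>

lemma AE_zero_of_box_integrals:
  fixes h :: "'a::euclidean_space \<Rightarrow> real"
  assumes h: "integrable lborel h"
    and box: "\<And>a b. (LINT x:box a b|lborel. h x) = 0"
  shows "AE x in lborel. h x = 0"
proof (rule density_unique_real[OF h integrable_zero])
  have int: "set_integrable lborel B h" if "B \<in> sets borel" for B
    using h that integrable_mult_indicator[of B lborel h] by (simp add: set_integrable_def)
  let ?B = "\<lambda>n::nat. box (- (real n *\<^sub>R One)) (real n *\<^sub>R One) :: 'a set"
  \<comment> \<open>The complement step of the Dynkin argument needs the integral over the whole
    space, obtained here as a limit over growing boxes.\<close>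
  have "(\<lambda>n. LINT x:?B n|lborel. h x) \<longlonglongrightarrow> (LINT x:(\<Union>n. ?B n)|lborel. h x)"
  proof (rule set_integral_cont_up)
    show "incseq ?B"
    proof (rule incseq_SucI)
      fix n
      show "?B n \<subseteq> ?B (Suc n)" by (force simp: mem_box inner_simps)
    qed
  qed (auto intro: int)
  then have total: "(LINT x:UNIV|lborel. h x) = 0"
    by (simp add: box UN_box_eq_UNIV LIMSEQ_const_iff)
  fix A :: "'a set" assume "A \<in> sets lborel"
  then have A: "A \<in> sigma_sets UNIV (range (\<lambda>(a, b). box a b))"
    by (simp add: borel_eq_box)
  have "Int_stable (range (\<lambda>(a, b). box a b :: 'a set))"
    by (auto simp: Int_stable_def box_Int_box)
  moreover have "range (\<lambda>(a, b). box a b) \<subseteq> Pow (UNIV :: 'a set)" by simp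
  ultimately have "(LINT x:A|lborel. h x) = 0"
    using A
  proof (induction rule: sigma_sets_induct_disjoint)
    case (compl A)
    then have A: "A \<in> sets borel" by (simp add: borel_eq_box)
    have "(LINT x:A \<union> (UNIV - A)|lborel. h x) = (LINT x:A|lborel. h x) + (LINT x:UNIV - A|lborel. h x)"
      by (rule set_integral_Un) (use A in \<open>auto intro!: int\<close>)
    with compl total show ?case by simp
  next
    case (union F)
    then have F: "F i \<in> sets borel" for i by (auto simp: borel_eq_box)
    have "(LINT x:(\<Union>i. F i)|lborel. h x) = (\<Sum>i. LINT x:F i|lborel. h x)"
      by (rule lebesgue_integral_countable_add)
         (use F union(1) in \<open>auto intro!: int simp: disjoint_family_on_def\<close>)
    with union show ?case by simp
  qed (use box in \<open>auto simp: set_lebesgue_integral_def\<close>)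
  then show "(LINT x:A|lborel. h x) = (LINT x:A|lborel. 0)"
    by (simp add: set_lebesgue_integral_def)
qed

text \<open>The Dynkin argument lives on Borel sets; a Borel representative of h transfers it to the
  completed measure.\<close>

lemma AE_zero_of_box_integrals_lebesgue:
  fixes h :: "'a::euclidean_space \<Rightarrow> real"
  assumes h: "integrable lebesgue h"
    and box: "\<And>a b. (LINT x:box a b|lebesgue. h x) = 0"
  shows "AE x in lebesgue. h x = 0"
proof -
  obtain h' where h'[measurable]: "h' \<in> borel_measurable lborel" and ae: "AE x in lborel. h x = h' x"
    using completion_ex_borel_measurable_real[OF borel_measurable_integrable[OF h]] by auto
  from ae have ae': "AE x in lebesgue. h x = h' x" by (rule AE_completion)
  have [measurable]: "h \<in> borel_measurable lebesgue" "h' \<in> borel_measurable lebesgue"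
    using h h' by (auto intro: measurable_completion)
  have "integrable lebesgue h'"
    using h integrable_cong_AE[OF _ _ ae'] by simp
  then have "integrable lborel h'" by (simp add: integrable_completion)
  moreover have "(LINT x:box a b|lborel. h' x) = 0" for a b
  proof -
    have "(LINT x:box a b|lborel. h' x) = (LINT x:box a b|lebesgue. h' x)"
      by (simp add: set_lebesgue_integral_def integral_completion)
    also have "\<dots> = (LINT x:box a b|lebesgue. h x)"
      unfolding set_lebesgue_integral_def
      by (rule integral_cong_AE) (use ae' in \<open>auto intro!: borel_measurable_times borel_measurable_indicator\<close>)
    finally show ?thesis using box by simp
  qed
  ultimately have "AE x in lborel. h' x = 0" by (rule AE_zero_of_box_integrals)
  then have "AE x in lebesgue. h' x = 0" by (rule AE_completion)
  with ae' show ?thesis by eventually_elim simp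
qed

text \<open>The hypotheses give integrability only on closed boxes inside \<Omega>, so h is cut off
  to such a box before the global result applies, and \<Omega> is then covered by countably many of
  them.\<close>

lemma AE_zero_of_test_integrals:
  fixes h :: "'a::euclidean_space \<Rightarrow> real"
  assumes \<Omega>: "open \<Omega>"
    and loc: "\<And>a b. cbox a b \<subseteq> \<Omega> \<Longrightarrow> set_integrable lebesgue (cbox a b) h"
    and zero: "\<And>\<phi>. test_fun \<Omega> \<phi> \<Longrightarrow> (LINT x:\<Omega>|lebesgue. h x * \<phi> x) = 0"
  shows "AE x in lebesgue. x \<in> \<Omega> \<longrightarrow> h x = 0"
proof -
  have box0: "(LINT x:box a b|lebesgue. h x) = 0" if ab: "cbox a b \<subseteq> \<Omega>" for a b
  proof -
    \<comment> \<open>Cutting h off yields a single integrable function that dominates all h *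
      \<open>box_bump a b n\<close>.\<close>
    define H where "H x = indicator (cbox a b) x *\<^sub>R h x" for x
    let ?s = "\<lambda>n x. indicator \<Omega> x *\<^sub>R (h x * box_bump a b n x)"
    have H: "integrable lebesgue H"
      using loc[OF ab] by (simp add: set_integrable_def H_def[abs_def])
    then have [measurable]: "H \<in> borel_measurable lebesgue"
      by simp
    have sub: "box a b \<subseteq> cbox a b" by (rule box_subset_cbox)
    have s: "?s n x = H x * box_bump a b n x" for n x
      using ab sub by (cases "x \<in> box a b") (auto simp: box_bump_eq_0_iff indicator_def H_def)
    have l: "indicator (box a b) x *\<^sub>R h x = H x * indicator (box a b) x" for x
      using sub by (auto simp: indicator_def H_def)
    have [measurable]: "box a b \<in> sets lebesgue" by simp
    have [measurable]: "box_bump a b n \<in> borel_measurable lebesgue" for n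
      using test_fun_box_bump[of a b UNIV n] by (simp add: test_fun_def smooth_fun_measurable)
    have "(\<lambda>n. integral\<^sup>L lebesgue (?s n)) \<longlonglongrightarrow> integral\<^sup>L lebesgue (\<lambda>x. indicator (box a b) x *\<^sub>R h x)"
      unfolding s l
    proof (rule integral_dominated_convergence)
      show "integrable lebesgue (\<lambda>x. \<bar>H x\<bar>)"
        using H by simp
      show "AE x in lebesgue. (\<lambda>n. H x * box_bump a b n x) \<longlonglongrightarrow> H x * indicator (box a b) x"
        by (intro AE_I2 tendsto_mult tendsto_const box_bump_tendsto)
      show "AE x in lebesgue. norm (H x * box_bump a b n x) \<le> \<bar>H x\<bar>" for n
        using box_bump_bounds[of a b n]
        by (intro AE_I2) (auto simp: abs_mult intro!: mult_left_le)
    qed (auto intro!: borel_measurable_times borel_measurable_indicator)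
    moreover have "integral\<^sup>L lebesgue (?s n) = 0" for n
      using zero[OF test_fun_box_bump[OF ab]] by (simp add: set_lebesgue_integral_def)
    ultimately show ?thesis
      by (simp add: set_lebesgue_integral_def LIMSEQ_const_iff)
  qed
  have cbox: "AE x in lebesgue. x \<in> cbox c d \<longrightarrow> h x = 0" if cd: "cbox c d \<subseteq> \<Omega>" for c d
  proof -
    have sub: "box c d \<subseteq> cbox c d" by (rule box_subset_cbox)
    have "set_integrable lebesgue (box c d) h"
      by (rule set_integrable_subset[OF loc[OF cd]]) (auto intro: sub[THEN subsetD])
    then have "integrable lebesgue (\<lambda>x. indicator (box c d) x * h x)"
      by (simp add: set_integrable_def)
    moreover have "(LINT x:box a b|lebesgue. indicator (box c d) x * h x) = 0" for a b
    proof -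
      \<comment> \<open>The cut-off function integrated over any box a b sees only the intersection
        with box c d. That is again a box, and its closed version still lies in \<Omega>, so
        \<open>box0\<close> applies.\<close>
      let ?l = "\<Sum>i\<in>Basis. max (a \<bullet> i) (c \<bullet> i) *\<^sub>R i" and ?u = "\<Sum>i\<in>Basis. min (b \<bullet> i) (d \<bullet> i) *\<^sub>R i"
      have "cbox ?l ?u \<subseteq> \<Omega>" using cd Int_interval[of a b c d] by blast
      from box0[OF this] show ?thesis
        by (simp add: set_lebesgue_integral_def box_Int_box[symmetric] indicator_inter_arith mult.assoc)
    qed
    ultimately have "AE x in lebesgue. indicator (box c d) x * h x = 0"
      by (rule AE_zero_of_box_integrals_lebesgue)
    \<comment> \<open>The covering below uses closed boxes, so the null frontier has to be
      discarded.\<close>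
    moreover have "AE x in lebesgue. x \<notin> cbox c d - box c d"
      using negligible_frontier_interval[of c d] AE_not_in negligible_iff_null_sets by blast
    ultimately show ?thesis
      by eventually_elim (auto simp: indicator_def split: if_splits)
  qed
  obtain D where D: "countable D" "D \<subseteq> Pow \<Omega>" "\<And>X. X \<in> D \<Longrightarrow> \<exists>a b. X = cbox a b" "\<Union>D = \<Omega>"
    using open_countable_Union_open_cbox[OF \<Omega>] by metis
  have "AE x in lebesgue. \<forall>X\<in>D. x \<in> X \<longrightarrow> h x = 0"
  proof (subst AE_ball_countable[OF D(1)], rule ballI)
    fix X assume "X \<in> D"
    then show "AE x in lebesgue. x \<in> X \<longrightarrow> h x = 0"
      using D cbox by (metis PowD subsetD)
  qed
  then show ?thesis by eventually_elim (use D(4) in blast)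
qed

text \<open>The elementary bound |t| \<le> 1 + |t|^r replaces Hoelder: on the compact set K the
  constant 1 is integrable, and |f|^r is integrable on \<Omega>.\<close>

lemma set_integrable_in_Lr_mult:
  fixes f w :: "'a::euclidean_space \<Rightarrow> real"
  assumes f: "in_Lr r \<Omega> f" and r: "1 \<le> r" and w[measurable]: "w \<in> borel_measurable lebesgue"
    and M: "\<And>x. \<bar>w x\<bar> \<le> M" and K: "compact K" "\<And>x. x \<notin> K \<Longrightarrow> w x = 0"
  shows "set_integrable lebesgue \<Omega> (\<lambda>x. f x * w x)"
  unfolding set_integrable_def
proof (rule integrableI_bounded)
  define F where "F x = indicator \<Omega> x *\<^sub>R f x" for x
  have [measurable]: "F \<in> borel_measurable lebesgue" and fin: "Lr_int r \<Omega> f < \<infinity>"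
    using f by (auto simp: in_Lr_def F_def[abs_def])
  have [measurable]: "K \<in> sets lebesgue" using K(1) by (simp add: borel_compact)
  have M0: "0 \<le> M" using M[of undefined] by linarith
  have [measurable]: "(\<lambda>x. ennreal (norm (F x) powr r)) \<in> borel_measurable lebesgue"
    by (intro measurable_compose[OF _ measurable_ennreal] powr_real_measurable borel_measurable_norm) simp_all
  have "(\<lambda>x. F x * w x) \<in> borel_measurable lebesgue"
    by simp
  then show "(\<lambda>x. indicat_real \<Omega> x *\<^sub>R (f x * w x)) \<in> borel_measurable lebesgue"
    by (simp add: mult.assoc F_def)
  have eq: "indicator \<Omega> x * ennreal (norm (f x) powr r) = ennreal (norm (F x) powr r)" for x
    by (auto simp: indicator_def F_def)
  have pt: "ennreal (norm (indicat_real \<Omega> x *\<^sub>R (f x * w x)))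
      \<le> ennreal M * (indicator K x + indicator \<Omega> x * ennreal (norm (f x) powr r))" for x
  proof (cases "x \<in> \<Omega> \<and> x \<in> K")
    case True
    have "\<bar>f x\<bar> \<le> 1 + \<bar>f x\<bar> powr r"
    proof (cases "\<bar>f x\<bar> \<le> 1")
      case False
      then have "\<bar>f x\<bar> powr 1 \<le> \<bar>f x\<bar> powr r" by (intro powr_mono r) auto
      then show ?thesis using False by simp
    qed (simp add: add_increasing2)
    then have "\<bar>f x\<bar> * \<bar>w x\<bar> \<le> (1 + \<bar>f x\<bar> powr r) * M"
      by (intro mult_mono M) (auto simp: add_nonneg_nonneg)
    then show ?thesis using True M0
      by (simp add: abs_mult ennreal_mult[symmetric] ennreal_plus[symmetric] mult.commute
            ennreal_1[symmetric] del: ennreal_plus ennreal_1)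
  qed (use K(2) in auto)
  have "(\<integral>\<^sup>+ x. ennreal (norm (indicat_real \<Omega> x *\<^sub>R (f x * w x))) \<partial>lebesgue)
      \<le> (\<integral>\<^sup>+ x. ennreal M * (indicator K x + indicator \<Omega> x * ennreal (norm (f x) powr r)) \<partial>lebesgue)"
    by (rule nn_integral_mono) (rule pt)
  also have "\<dots> = ennreal M * (emeasure lebesgue K + Lr_int r \<Omega> f)"
    unfolding Lr_int_def eq
    by (simp add: nn_integral_cmult nn_integral_add)
  also have "\<dots> < \<infinity>"
    using fin lmeasurable_compact[OF K(1)]
    by (simp add: ennreal_mult_less_top fmeasurable_def del: emeasure_completion)
  finally show "(\<integral>\<^sup>+ x. ennreal (norm (indicat_real \<Omega> x *\<^sub>R (f x * w x))) \<partial>lebesgue) < \<infinity>" .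
qed

lemma in_Lr_inner:
  fixes g :: "'a::euclidean_space \<Rightarrow> 'a"
  assumes g: "in_Lr r \<Omega> g" and i: "i \<in> Basis" and r: "0 \<le> r"
  shows "in_Lr r \<Omega> (\<lambda>x. g x \<bullet> i)"
proof -
  have [measurable]: "(\<lambda>x. indicator \<Omega> x *\<^sub>R g x) \<in> borel_measurable lebesgue"
    using g by (simp add: in_Lr_def)
  have "(\<lambda>x. (indicator \<Omega> x *\<^sub>R g x) \<bullet> i) \<in> borel_measurable lebesgue"
    by measurable
  moreover have "Lr_int r \<Omega> (\<lambda>x. g x \<bullet> i) \<le> Lr_int r \<Omega> g"
    unfolding Lr_int_def
    by (intro nn_integral_mono mult_left_mono ennreal_leI powr_mono2 r) (auto simp: Basis_le_norm i)
  ultimately show ?thesis using g by (auto simp: in_Lr_def)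
qed

text \<open>The fundamental lemma is applied to each coordinate of g - g'. Local integrability comes
  from the L^r bound, with the indicator of a closed box as the weight in
  \<open>set_integrable_in_Lr_mult\<close>.\<close>

lemma weak_grad_unique:
  fixes g g' :: "'a::euclidean_space \<Rightarrow> 'a"
  assumes \<Omega>: "open \<Omega>" and r: "1 \<le> r"
    and g: "in_Lr r \<Omega> g" "weak_grad \<Omega> u g" and g': "in_Lr r \<Omega> g'" "weak_grad \<Omega> u g'"
  shows "AE x in lebesgue. x \<in> \<Omega> \<longrightarrow> g x = g' x"
proof -
  have "AE x in lebesgue. x \<in> \<Omega> \<longrightarrow> g x \<bullet> i - g' x \<bullet> i = 0" if i: "i \<in> Basis" for i
  proof (rule AE_zero_of_test_integrals[OF \<Omega>])
    fix a b :: 'a assume ab: "cbox a b \<subseteq> \<Omega>"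
    have "set_integrable lebesgue (cbox a b) (\<lambda>x. k x \<bullet> i)" if k: "in_Lr r \<Omega> k" for k
    proof -
      have "set_integrable lebesgue \<Omega> (\<lambda>x. (k x \<bullet> i) * indicator (cbox a b) x)"
      proof (rule set_integrable_in_Lr_mult[OF _ r])
        show "in_Lr r \<Omega> (\<lambda>x. k x \<bullet> i)" using r by (intro in_Lr_inner[OF k i]) simp
        show "indicat_real (cbox a b) \<in> borel_measurable lebesgue"
          by (rule borel_measurable_indicator) simp
        show "\<bar>indicat_real (cbox a b) x\<bar> \<le> 1" for x by simp
        show "compact (cbox a b)" by simp
        show "x \<notin> cbox a b \<Longrightarrow> indicat_real (cbox a b) x = 0" for x by simp
      qed
      moreover have "indicator \<Omega> x *\<^sub>R ((k x \<bullet> i) * indicator (cbox a b) x) = indicator (cbox a b) x *\<^sub>R (k x \<bullet> i)" for x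
        using ab by (auto simp: indicator_def)
      ultimately show ?thesis by (simp only: set_integrable_def)
    qed
    then show "set_integrable lebesgue (cbox a b) (\<lambda>x. g x \<bullet> i - g' x \<bullet> i)"
      using g(1) g'(1) by (intro set_integral_diff) auto
  next
    fix \<phi> :: "'a \<Rightarrow> real" assume "test_fun \<Omega> \<phi>"
    then show "(LINT x:\<Omega>|lebesgue. (g x \<bullet> i - g' x \<bullet> i) * \<phi> x) = 0"
      using g(2) g'(2) i by (auto simp: weak_grad_def left_diff_distrib set_integral_diff)
  qed
  then have "AE x in lebesgue. \<forall>i\<in>Basis. x \<in> \<Omega> \<longrightarrow> g x \<bullet> i - g' x \<bullet> i = 0"
    by (subst AE_finite_all) auto
  then show ?thesis by eventually_elim (simp add: euclidean_eq_iff[where 'a='a])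
qed

text \<open>Lets the norm be computed from an explicitly known weak gradient, such as
  \<open>glue_grad\<close>.\<close>

lemma W1_normr_eq:
  fixes u :: "'a::euclidean_space \<Rightarrow> real"
  assumes "open \<Omega>" "1 \<le> r" "in_Lr r \<Omega> g" "weak_grad \<Omega> u g"
  shows "W1_normr r \<Omega> u = (\<integral>\<^sup>+ x. indicator \<Omega> x * ennreal (\<bar>u x\<bar> powr r + norm (g x) powr r) \<partial>lebesgue)"
proof -
  have "in_Lr r \<Omega> (wgrad r \<Omega> u) \<and> weak_grad \<Omega> u (wgrad r \<Omega> u)"
    unfolding wgrad_def by (rule someI[of _ g]) (use assms in blast)
  with assms have "AE x in lebesgue. x \<in> \<Omega> \<longrightarrow> wgrad r \<Omega> u x = g x"
    by (intro weak_grad_unique) auto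
  then show ?thesis
    unfolding W1_normr_def by (intro nn_integral_cong_AE) (auto simp: indicator_def elim!: eventually_mono)
qed

section \<open>Locally finite sums of weakly differentiable functions\<close>

lemma norm_add_powr_le:
  fixes a b :: "'b::real_normed_vector"
  assumes "0 \<le> q"
  shows "norm (a + b) powr q \<le> 2 powr q * (norm a powr q + norm b powr q)"
proof -
  have "norm (a + b) \<le> 2 * max (norm a) (norm b)"
    using norm_triangle_ineq[of a b] by linarith
  then have "norm (a + b) powr q \<le> (2 * max (norm a) (norm b)) powr q"
    using assms by (intro powr_mono2) auto
  also have "\<dots> = 2 powr q * max (norm a) (norm b) powr q"
    by (simp add: powr_mult)
  also have "\<dots> \<le> 2 powr q * (norm a powr q + norm b powr q)"
    by (intro mult_left_mono) (auto simp: max_def)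
  finally show ?thesis .
qed

text \<open>The sum is at most N times its largest term, which avoids convexity. It is used with N =
  3, the overlap number of the shells.\<close>

lemma norm_sum_powr_le:
  fixes a :: "'i \<Rightarrow> 'b::real_normed_vector"
  assumes "finite S" "card S \<le> N" "0 \<le> q"
  shows "norm (sum a S) powr q \<le> real N powr q * (\<Sum>k\<in>S. norm (a k) powr q)"
proof (cases "S = {}")
  case False
  define m where "m = Max ((\<lambda>k. norm (a k)) ` S)"
  have m: "norm (a k) \<le> m" if "k \<in> S" for k
    using that assms(1) by (simp add: m_def)
  have "m \<in> (\<lambda>k. norm (a k)) ` S"
    unfolding m_def using False assms(1) by (intro Max_in) auto
  then obtain j where j: "j \<in> S" "m = norm (a j)" by auto
  have "norm (sum a S) \<le> real (card S) * m"
    by (rule sum_norm_bound) (rule m)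
  also have "\<dots> \<le> real N * m"
    using assms(2) j by (intro mult_right_mono) auto
  finally have "norm (sum a S) powr q \<le> (real N * m) powr q"
    using assms by (intro powr_mono2) auto
  also have "\<dots> = real N powr q * norm (a j) powr q"
    using j by (simp add: powr_mult)
  also have "\<dots> \<le> real N powr q * (\<Sum>k\<in>S. norm (a k) powr q)"
    by (intro mult_left_mono member_le_sum[of j S "\<lambda>k. norm (a k) powr q"]) (use assms j in auto)
  finally show ?thesis .
qed simp

section \<open>Linear structure of L^r, weak gradients and W^{1,r}\<close>

lemma indicator_mult_powr:
  "indicator \<Omega> x * ennreal (norm (f x) powr r) = ennreal (norm (indicat_real \<Omega> x *\<^sub>R f x) powr r)"
  by (auto simp: indicator_def)

lemma in_Lr_add:
  fixes f g :: "'a::euclidean_space \<Rightarrow> 'b::{real_normed_vector, second_countable_topology}"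
  assumes "in_Lr r \<Omega> f" "in_Lr r \<Omega> g" "0 \<le> r"
  shows "in_Lr r \<Omega> (\<lambda>x. f x + g x)"
proof -
  define F where "F x = indicat_real \<Omega> x *\<^sub>R f x" for x
  define G where "G x = indicat_real \<Omega> x *\<^sub>R g x" for x
  have [measurable]: "F \<in> borel_measurable lebesgue" "G \<in> borel_measurable lebesgue"
    and fin: "(\<integral>\<^sup>+ x. ennreal (norm (F x) powr r) \<partial>lebesgue) < \<infinity>"
      "(\<integral>\<^sup>+ x. ennreal (norm (G x) powr r) \<partial>lebesgue) < \<infinity>"
    using assms by (auto simp: in_Lr_def Lr_int_def F_def[abs_def] G_def[abs_def] indicator_mult_powr)
  have [measurable]: "(\<lambda>x. ennreal (norm (F x) powr r)) \<in> borel_measurable lebesgue"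
    "(\<lambda>x. ennreal (norm (G x) powr r)) \<in> borel_measurable lebesgue"
    by (intro measurable_compose[OF _ measurable_ennreal] powr_real_measurable borel_measurable_norm;
        simp)+
  have "(\<lambda>x. F x + G x) \<in> borel_measurable lebesgue" by simp
  then have meas: "(\<lambda>x. indicat_real \<Omega> x *\<^sub>R (f x + g x)) \<in> borel_measurable lebesgue"
    by (simp add: F_def G_def scaleR_right_distrib)
  have "Lr_int r \<Omega> (\<lambda>x. f x + g x) = (\<integral>\<^sup>+ x. ennreal (norm (F x + G x) powr r) \<partial>lebesgue)"
    by (auto simp: Lr_int_def F_def G_def intro!: nn_integral_cong split: split_indicator)
  also have "\<dots> \<le> (\<integral>\<^sup>+ x. ennreal (2 powr r) * (ennreal (norm (F x) powr r) + ennreal (norm (G x) powr r)) \<partial>lebesgue)"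
    by (intro nn_integral_mono)
       (simp add: ennreal_mult[symmetric] ennreal_plus[symmetric] norm_add_powr_le assms del: ennreal_plus)
  also have "\<dots> = ennreal (2 powr r) * ((\<integral>\<^sup>+ x. ennreal (norm (F x) powr r) \<partial>lebesgue) +
      (\<integral>\<^sup>+ x. ennreal (norm (G x) powr r) \<partial>lebesgue))"
    by (simp add: nn_integral_cmult nn_integral_add)
  also have "\<dots> < \<infinity>"
    using fin by (simp add: ennreal_mult_less_top)
  finally show ?thesis using meas by (simp add: in_Lr_def)
qed

lemma in_Lr_minus:
  fixes f :: "'a::euclidean_space \<Rightarrow> 'b::{real_normed_vector, second_countable_topology}"
  assumes "in_Lr r \<Omega> f"
  shows "in_Lr r \<Omega> (\<lambda>x. - f x)"
  using assms by (simp add: in_Lr_def Lr_int_def)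

lemma weak_grad_add:
  assumes "weak_grad \<Omega> u g" "weak_grad \<Omega> v h"
  shows "weak_grad \<Omega> (\<lambda>x. u x + v x) (\<lambda>x. g x + h x)"
  using assms unfolding weak_grad_def
  by (auto simp: inner_add_left distrib_right set_integral_add)

lemma weak_grad_minus:
  assumes "weak_grad \<Omega> u g"
  shows "weak_grad \<Omega> (\<lambda>x. - u x) (\<lambda>x. - g x)"
  using assms unfolding weak_grad_def
  by (auto simp: set_integrable_def set_lebesgue_integral_def)

lemma weak_grad_0: "weak_grad \<Omega> (\<lambda>x. 0) (\<lambda>x. 0)"
  by (simp add: weak_grad_def set_integrable_def)

lemma weak_grad_sum:
  assumes "\<And>k. k \<in> S \<Longrightarrow> weak_grad \<Omega> (u k) (g k)"
  shows "weak_grad \<Omega> (\<lambda>x. \<Sum>k\<in>S. u k x) (\<lambda>x. \<Sum>k\<in>S. g k x)"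
  using assms
proof (induction S rule: infinite_finite_induct)
  case (insert k S)
  then show ?case using weak_grad_add[of \<Omega> "u k" "g k"] by simp
qed (simp_all add: weak_grad_0)

lemma W1I: "in_Lr r \<Omega> u \<Longrightarrow> in_Lr r \<Omega> g \<Longrightarrow> weak_grad \<Omega> u g \<Longrightarrow> u \<in> W1 r \<Omega>"
  by (auto simp: W1_def)

lemma W1_in_Lr: "u \<in> W1 r \<Omega> \<Longrightarrow> in_Lr r \<Omega> u"
  by (simp add: W1_def)

lemma wgrad_works:
  assumes "u \<in> W1 r \<Omega>"
  shows "in_Lr r \<Omega> (wgrad r \<Omega> u)" "weak_grad \<Omega> u (wgrad r \<Omega> u)"
proof -
  have "\<exists>g. in_Lr r \<Omega> g \<and> weak_grad \<Omega> u g" using assms by (simp add: W1_def)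
  from someI_ex[OF this] show "in_Lr r \<Omega> (wgrad r \<Omega> u)" "weak_grad \<Omega> u (wgrad r \<Omega> u)"
    by (simp_all add: wgrad_def)
qed

lemma W1_add:
  assumes "u \<in> W1 r \<Omega>" "v \<in> W1 r \<Omega>" "0 \<le> r"
  shows "(\<lambda>x. u x + v x) \<in> W1 r \<Omega>"
  by (rule W1I[OF in_Lr_add in_Lr_add weak_grad_add]) (rule assms W1_in_Lr wgrad_works)+

lemma W1_minus:
  assumes "u \<in> W1 r \<Omega>"
  shows "(\<lambda>x. - u x) \<in> W1 r \<Omega>"
  by (rule W1I[OF in_Lr_minus in_Lr_minus weak_grad_minus]) (rule assms W1_in_Lr wgrad_works)+

lemma W1_diff: "u \<in> W1 r \<Omega> \<Longrightarrow> v \<in> W1 r \<Omega> \<Longrightarrow> 0 \<le> r \<Longrightarrow> (\<lambda>x. u x - v x) \<in> W1 r \<Omega>"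
  using W1_add[OF _ W1_minus, of u r \<Omega> v] by simp

section \<open>Product rule and locality of weak gradients\<close>

definition gradient :: "('a::euclidean_space \<Rightarrow> real) \<Rightarrow> 'a \<Rightarrow> 'a" where
  "gradient f x = (\<Sum>i\<in>Basis. frechet_derivative f (at x) i *\<^sub>R i)"

lemma gradient_inner: "i \<in> Basis \<Longrightarrow> gradient f x \<bullet> i = frechet_derivative f (at x) i"
  by (simp add: gradient_def)

lemma continuous_gradient: "smooth_fun f \<Longrightarrow> continuous_on S (gradient f)"
  unfolding gradient_def
  by (intro continuous_on_sum continuous_on_scaleR continuous_on_const
        smooth_fun_continuous_on smooth_fun_pderiv)

text \<open>Test the weak gradient of u with \<eta> * \<phi>. The classical product rule then leaves
  the extra term u * \<phi> * (partial derivative of \<eta>), which moves to the gradient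
  side.\<close>

lemma weak_grad_mult_smooth:
  assumes \<eta>: "smooth_fun \<eta>" and u: "in_Lr r \<Omega> u" "1 \<le> r" and g: "weak_grad \<Omega> u g"
  shows "weak_grad \<Omega> (\<lambda>x. \<eta> x * u x) (\<lambda>x. \<eta> x *\<^sub>R g x + u x *\<^sub>R gradient \<eta> x)"
  unfolding weak_grad_def
proof (intro allI impI ballI)
  fix \<phi> :: "'a \<Rightarrow> real" and i :: 'a
  assume \<phi>: "test_fun \<Omega> \<phi>" and i: "i \<in> Basis"
  then have \<phi>s: "smooth_fun \<phi>" by (simp add: test_fun_def)
  let ?D = "\<lambda>f x. frechet_derivative f (at x) i"
  define w where "w x = \<phi> x * ?D \<eta> x" for x
  have w: "smooth_fun w"
    unfolding w_def[abs_def] by (intro smooth_fun_mult \<phi>s smooth_fun_pderiv \<eta> i)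
  have supp: "w x = 0" if "x \<notin> closure {x. \<phi> x \<noteq> 0}" for x
    using that closure_subset[of "{x. \<phi> x \<noteq> 0}"] by (auto simp: w_def)
  have comp: "compact (closure {x. \<phi> x \<noteq> 0})" using \<phi> by (simp add: test_fun_def)
  obtain M where "\<And>x. \<bar>w x\<bar> \<le> M"
    using bounded_range_of_compact_support[OF smooth_fun_continuous_on[OF w] comp supp]
    by (metis real_norm_def)
  \<comment> \<open>Splitting the integrals below requires the extra term to be integrable by
    itself; this is where u in L^r and the compact support of \<phi> enter.\<close>
  then have uw: "set_integrable lebesgue \<Omega> (\<lambda>x. u x * w x)"
    by (intro set_integrable_in_Lr_mult[OF u smooth_fun_measurable[OF w] _ comp supp])
  have "?D (\<lambda>x. \<eta> x * \<phi> x) x = \<eta> x * ?D \<phi> x + ?D \<eta> x * \<phi> x" for x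
    by (subst frechet_derivative_eq[OF has_derivative_mult[OF smooth_fun_has_derivative[OF \<eta>]
          smooth_fun_has_derivative[OF \<phi>s]]]) simp
  then have D: "\<eta> x * u x * ?D \<phi> x = u x * ?D (\<lambda>x. \<eta> x * \<phi> x) x - u x * w x" for x
    by (simp add: w_def algebra_simps)
  have G: "((\<eta> x *\<^sub>R g x + u x *\<^sub>R gradient \<eta> x) \<bullet> i) * \<phi> x = (g x \<bullet> i) * (\<eta> x * \<phi> x) + u x * w x" for x
    using i by (simp add: inner_add_left gradient_inner w_def algebra_simps)
  have "test_fun \<Omega> (\<lambda>x. \<eta> x * \<phi> x)" by (rule test_fun_mult_smooth[OF \<eta> \<phi>])
  with g i have
    "set_integrable lebesgue \<Omega> (\<lambda>x. u x * ?D (\<lambda>x. \<eta> x * \<phi> x) x)"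
    "set_integrable lebesgue \<Omega> (\<lambda>x. (g x \<bullet> i) * (\<eta> x * \<phi> x))"
    "(LINT x:\<Omega>|lebesgue. u x * ?D (\<lambda>x. \<eta> x * \<phi> x) x) = - (LINT x:\<Omega>|lebesgue. (g x \<bullet> i) * (\<eta> x * \<phi> x))"
    unfolding weak_grad_def by blast+
  with uw show "set_integrable lebesgue \<Omega> (\<lambda>x. \<eta> x * u x * ?D \<phi> x) \<and>
      set_integrable lebesgue \<Omega> (\<lambda>x. ((\<eta> x *\<^sub>R g x + u x *\<^sub>R gradient \<eta> x) \<bullet> i) * \<phi> x) \<and>
      (LINT x:\<Omega>|lebesgue. \<eta> x * u x * ?D \<phi> x) =
        - (LINT x:\<Omega>|lebesgue. ((\<eta> x *\<^sub>R g x + u x *\<^sub>R gradient \<eta> x) \<bullet> i) * \<phi> x)"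
    unfolding D G by (simp add: set_integral_add set_integral_diff)
qed

text \<open>A test function sees only a bounded set, so it suffices that on each ball u and g agree
  with some weakly differentiable pair. This reduces a locally finite sum to finite ones.\<close>

lemma weak_grad_exhaust:
  assumes "\<And>N::nat. \<exists>v h. weak_grad \<Omega> v h \<and> (\<forall>x. x \<bullet> x \<le> real N \<longrightarrow> u x = v x \<and> g x = h x)"
  shows "weak_grad \<Omega> u g"
  unfolding weak_grad_def
proof (intro allI impI ballI)
  fix \<phi> :: "'a \<Rightarrow> real" and i :: 'a
  assume \<phi>: "test_fun \<Omega> \<phi>" and i: "i \<in> Basis"
  let ?K = "closure {x. \<phi> x \<noteq> 0}"
  obtain R where R: "\<And>x. x \<in> ?K \<Longrightarrow> norm x \<le> R"
    using \<phi> unfolding test_fun_def by (meson bounded_iff compact_imp_bounded)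
  obtain N :: nat where N: "R\<^sup>2 \<le> real N" using real_arch_simple by blast
  obtain v h where vh: "weak_grad \<Omega> v h" "\<And>x. x \<bullet> x \<le> real N \<Longrightarrow> u x = v x \<and> g x = h x"
    using assms by metis
  have eq: "u x = v x \<and> g x = h x" if "x \<in> ?K" for x
  proof -
    have "(norm x)\<^sup>2 \<le> R\<^sup>2" using R[OF that] by (intro power_mono) auto
    then show ?thesis using N vh(2) by (simp add: power2_norm_eq_inner)
  qed
  have "(\<lambda>x. u x * frechet_derivative \<phi> (at x) i) = (\<lambda>x. v x * frechet_derivative \<phi> (at x) i)"
  proof
    fix x show "u x * frechet_derivative \<phi> (at x) i = v x * frechet_derivative \<phi> (at x) i"
      by (cases "x \<in> ?K") (auto simp: eq frechet_derivative_outside_support)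
  qed
  moreover have "(\<lambda>x. (g x \<bullet> i) * \<phi> x) = (\<lambda>x. (h x \<bullet> i) * \<phi> x)"
  proof
    fix x show "(g x \<bullet> i) * \<phi> x = (h x \<bullet> i) * \<phi> x"
      using eq closure_subset[of "{x. \<phi> x \<noteq> 0}"] by (cases "\<phi> x = 0") auto
  qed
  ultimately show "set_integrable lebesgue \<Omega> (\<lambda>x. u x * frechet_derivative \<phi> (at x) i) \<and>
      set_integrable lebesgue \<Omega> (\<lambda>x. (g x \<bullet> i) * \<phi> x) \<and>
      (LINT x:\<Omega>|lebesgue. u x * frechet_derivative \<phi> (at x) i) = - (LINT x:\<Omega>|lebesgue. (g x \<bullet> i) * \<phi> x)"
    using vh(1) \<phi> i unfolding weak_grad_def by (simp only:)
qed

section \<open>Gluing along the shells\<close>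

lemma shell_indices: "finite {k. x \<in> shell k}" "card {k. x \<in> shell k} \<le> 3"
proof -
  \<comment> \<open>The least possible index: k lies within 1 of x . x, an interval of length 2,
    which contains at most three integers.\<close>
  define n where "n = nat \<lceil>x \<bullet> x - 1\<rceil>"
  have "{k. x \<in> shell k} \<subseteq> {n..n + 2}"
  proof
    fix k assume "k \<in> {k. x \<in> shell k}"
    then have "\<bar>real k - x \<bullet> x\<bar> \<le> 1" by (simp add: shell_def)
    then show "k \<in> {n..n + 2}"
      unfolding n_def by (simp add: nat_le_iff le_nat_iff) linarith
  qed
  then show "finite {k. x \<in> shell k}" "card {k. x \<in> shell k} \<le> 3"
    using finite_subset card_mono[of "{n..n + 2}"] by auto
qed

lemma shell_bump_outside:
  assumes "x \<notin> shell k"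
  shows "shell_bump k x = 0" "gradient (shell_bump k) x = 0"
proof -
  have "x \<notin> closure {x. shell_bump k x \<noteq> 0}"
    using assms closure_shell_bump[of k] by auto
  then show "gradient (shell_bump k) x = 0"
    by (simp add: gradient_def frechet_derivative_outside_support)
  show "shell_bump k x = 0"
    using assms shell_bump_neq_0D[of k x] by (auto simp: shell_def)
qed

definition glue :: "(nat \<Rightarrow> 'a::euclidean_space \<Rightarrow> real) \<Rightarrow> 'a \<Rightarrow> real" where
  "glue d x = (\<Sum>k. shell_bump k x * d k x)"

text \<open>The product rule applied term by term; \<open>weak_grad_glue\<close> shows that it is a
  weak gradient of \<open>glue d\<close>.\<close>

definition glue_grad :: "(nat \<Rightarrow> 'a::euclidean_space \<Rightarrow> real) \<Rightarrow> (nat \<Rightarrow> 'a \<Rightarrow> 'a) \<Rightarrow> 'a \<Rightarrow> 'a" where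
  "glue_grad d h x = (\<Sum>k. shell_bump k x *\<^sub>R h k x + d k x *\<^sub>R gradient (shell_bump k) x)"

text \<open>S is left free for two uses: the exact index set of x gives pointwise bounds with at
  most three terms, while an initial segment gives one finite sum valid on a whole ball.\<close>

lemma glue_eq_sum:
  assumes "finite S" "{k. x \<in> shell k} \<subseteq> S"
  shows "glue d x = (\<Sum>k\<in>S. shell_bump k x * d k x)"
    "glue_grad d h x = (\<Sum>k\<in>S. shell_bump k x *\<^sub>R h k x + d k x *\<^sub>R gradient (shell_bump k) x)"
proof -
  have "x \<notin> shell k" if "k \<notin> S" for k using assms(2) that by auto
  then show "glue d x = (\<Sum>k\<in>S. shell_bump k x * d k x)"
    "glue_grad d h x = (\<Sum>k\<in>S. shell_bump k x *\<^sub>R h k x + d k x *\<^sub>R gradient (shell_bump k) x)"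
    unfolding glue_def glue_grad_def
    by (auto intro!: suminf_finite[OF assms(1)] simp: shell_bump_outside)
qed

lemma weak_grad_glue:
  assumes "1 \<le> r" "\<And>k. in_Lr r \<Omega> (d k)" "\<And>k. weak_grad \<Omega> (d k) (h k)"
  shows "weak_grad \<Omega> (glue d) (glue_grad d h)"
proof (rule weak_grad_exhaust)
  fix N :: nat
  \<comment> \<open>A shell that meets the region x . x \<le> N has index at most N + 1.\<close>
  let ?v = "\<lambda>x. \<Sum>k\<le>N + 1. shell_bump k x * d k x"
  let ?h = "\<lambda>x. \<Sum>k\<le>N + 1. shell_bump k x *\<^sub>R h k x + d k x *\<^sub>R gradient (shell_bump k) x"
  have "weak_grad \<Omega> ?v ?h"
    by (intro weak_grad_sum weak_grad_mult_smooth[where r=r] smooth_fun_shell_bump assms)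
  moreover have "glue d x = ?v x \<and> glue_grad d h x = ?h x" if "x \<bullet> x \<le> real N" for x
  proof -
    have "{k. x \<in> shell k} \<subseteq> {..N + 1}" using that by (auto simp: shell_def)
    then show ?thesis by (simp only: glue_eq_sum[OF finite_atMost] simp_thms)
  qed
  ultimately show "\<exists>v h'. weak_grad \<Omega> v h' \<and> (\<forall>x. x \<bullet> x \<le> real N \<longrightarrow> glue d x = v x \<and> glue_grad d h x = h' x)"
    by blast
qed

lemma shell_bump_bounded:
  obtains M where "M > 0" "\<And>x::'a::euclidean_space. \<bar>shell_bump k x\<bar> \<le> M"
    "\<And>x::'a::euclidean_space. norm (gradient (shell_bump k) x) \<le> M"
proof -
  obtain M1 where M1: "M1 > 0" "\<And>x::'a. norm (shell_bump k x) \<le> M1"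
    using bounded_range_of_compact_support[OF smooth_fun_continuous_on[OF smooth_fun_shell_bump[of k]]
        compact_shell shell_bump_outside(1)] by metis
  obtain M2 where M2: "M2 > 0" "\<And>x::'a. norm (gradient (shell_bump k) x) \<le> M2"
    using bounded_range_of_compact_support[OF continuous_gradient[OF smooth_fun_shell_bump[of k]]
        compact_shell shell_bump_outside(2)] by metis
  show ?thesis
    by (rule that[of "max M1 M2"]) (use M1 M2 in \<open>auto simp: le_max_iff_disj\<close>)
qed

text \<open>The order of quantifiers is the point: C depends on q and the bumps but not on d and h,
  so the functions to be glued can be chosen small relative to C.\<close>

lemma glue_bound:
  assumes q: "0 \<le> q"
  obtains C :: "nat \<Rightarrow> real" where "\<And>k. 0 < C k"
    "\<And>d h (x::'a::euclidean_space). \<bar>glue d x\<bar> powr q + norm (glue_grad d h x) powr q \<le>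
        (\<Sum>k | x \<in> shell k. C k * (\<bar>d k x\<bar> powr q + norm (h k x) powr q))"
proof -
  have "\<exists>M. \<forall>k. 0 < M k \<and> (\<forall>x::'a. \<bar>shell_bump k x\<bar> \<le> M k \<and> norm (gradient (shell_bump k) x) \<le> M k)"
    by (rule choice, rule allI, rule shell_bump_bounded) blast
  then obtain M where M: "\<And>k. 0 < M k" "\<And>k (x::'a). \<bar>shell_bump k x\<bar> \<le> M k"
    "\<And>k (x::'a). norm (gradient (shell_bump k) x) \<le> M k"
    by auto
  \<comment> \<open>3 powr q pays for at most three overlapping shells, 2 powr q for splitting the
    two terms of the product rule, and the summand 1 for \<open>glue d\<close> itself.\<close>
  define C where "C k = 3 powr q * (1 + 2 powr q) * M k powr q" for k
  show ?thesis
  proof (rule that[of C])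
    show "0 < C k" for k
      using M(1)[of k] by (auto simp: C_def intro!: mult_pos_pos add_pos_nonneg)
    fix d :: "nat \<Rightarrow> 'a \<Rightarrow> real" and h :: "nat \<Rightarrow> 'a \<Rightarrow> 'a" and x :: 'a
    let ?S = "{k. x \<in> shell k}"
    let ?t = "\<lambda>k. \<bar>d k x\<bar> powr q" and ?s = "\<lambda>k. norm (h k x) powr q"
    let ?G = "\<lambda>k. shell_bump k x *\<^sub>R h k x + d k x *\<^sub>R gradient (shell_bump k) x"
    have 1: "norm (shell_bump k x * d k x) powr q \<le> M k powr q * ?t k" for k
    proof -
      have "norm (shell_bump k x * d k x) \<le> M k * \<bar>d k x\<bar>"
        using M(2)[of k x] by (simp add: abs_mult mult_right_mono)
      then have "norm (shell_bump k x * d k x) powr q \<le> (M k * \<bar>d k x\<bar>) powr q"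
        using q by (intro powr_mono2) auto
      then show ?thesis using M(1)[of k] by (simp add: powr_mult)
    qed
    have 2: "norm (?G k) powr q \<le> 2 powr q * (M k powr q * (?t k + ?s k))" for k
    proof -
      have "norm (shell_bump k x *\<^sub>R h k x) \<le> M k * norm (h k x)"
        using M(2)[of k x] by (simp add: mult_right_mono)
      then have a: "norm (shell_bump k x *\<^sub>R h k x) powr q \<le> (M k * norm (h k x)) powr q"
        using q by (intro powr_mono2) auto
      have "norm (d k x *\<^sub>R gradient (shell_bump k) x) \<le> M k * \<bar>d k x\<bar>"
        using mult_left_mono[OF M(3)[of k x] abs_ge_zero[of "d k x"]] by (simp add: mult.commute)
      then have b: "norm (d k x *\<^sub>R gradient (shell_bump k) x) powr q \<le> (M k * \<bar>d k x\<bar>) powr q"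
        using q by (intro powr_mono2) auto
      have "norm (?G k) powr q \<le> 2 powr q * (norm (shell_bump k x *\<^sub>R h k x) powr q +
          norm (d k x *\<^sub>R gradient (shell_bump k) x) powr q)"
        by (rule norm_add_powr_le[OF q])
      also have "\<dots> \<le> 2 powr q * ((M k * norm (h k x)) powr q + (M k * \<bar>d k x\<bar>) powr q)"
        by (intro mult_left_mono add_mono a b) simp
      also have "\<dots> = 2 powr q * (M k powr q * (?t k + ?s k))"
        using M(1)[of k] by (simp add: powr_mult algebra_simps)
      finally show ?thesis .
    qed
    have "\<bar>glue d x\<bar> powr q \<le> 3 powr q * (\<Sum>k\<in>?S. norm (shell_bump k x * d k x) powr q)"
      using norm_sum_powr_le[OF shell_indices q, of "\<lambda>k. shell_bump k x * d k x" x]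
      by (simp add: glue_eq_sum[OF shell_indices(1) order_refl])
    also have "\<dots> \<le> 3 powr q * (\<Sum>k\<in>?S. M k powr q * ?t k)"
      by (intro mult_left_mono sum_mono 1) simp
    finally have A: "\<bar>glue d x\<bar> powr q \<le> 3 powr q * (\<Sum>k\<in>?S. M k powr q * ?t k)" .
    have "norm (glue_grad d h x) powr q \<le> 3 powr q * (\<Sum>k\<in>?S. norm (?G k) powr q)"
      using norm_sum_powr_le[OF shell_indices q, of ?G x]
      by (simp add: glue_eq_sum[OF shell_indices(1) order_refl])
    also have "\<dots> \<le> 3 powr q * (\<Sum>k\<in>?S. 2 powr q * (M k powr q * (?t k + ?s k)))"
      by (intro mult_left_mono sum_mono 2) simp
    finally have B: "norm (glue_grad d h x) powr q \<le>
        3 powr q * (\<Sum>k\<in>?S. 2 powr q * (M k powr q * (?t k + ?s k)))" .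
    have "\<bar>glue d x\<bar> powr q + norm (glue_grad d h x) powr q \<le>
        (\<Sum>k\<in>?S. 3 powr q * (M k powr q * ?t k) + 3 powr q * (2 powr q * (M k powr q * (?t k + ?s k))))"
      using A B by (simp add: sum_distrib_left sum.distrib)
    also have "\<dots> \<le> (\<Sum>k\<in>?S. C k * (?t k + ?s k))"
      by (intro sum_mono) (simp add: C_def algebra_simps)
    finally show "\<bar>glue d x\<bar> powr q + norm (glue_grad d h x) powr q \<le>
        (\<Sum>k\<in>?S. C k * (?t k + ?s k))" .
  qed
qed

text \<open>With the gradient as an argument, the energy can be restricted to \<Omega> \<inter>
  shell k, a set that need not be open, while the gradient remains the one taken on
  \<Omega>.\<close>

definition W1_int :: "real \<Rightarrow> 'a::euclidean_space set \<Rightarrow> ('a \<Rightarrow> real) \<Rightarrow> ('a \<Rightarrow> 'a) \<Rightarrow> ennreal" where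
  "W1_int r \<Omega> u g = (\<integral>\<^sup>+ x. indicator \<Omega> x * ennreal (\<bar>u x\<bar> powr r + norm (g x) powr r) \<partial>lebesgue)"

lemma W1_int_measurable:
  assumes "in_Lr p \<Omega> u" "in_Lr p \<Omega> g" "0 < r"
  shows "(\<lambda>x. indicator \<Omega> x * ennreal (\<bar>u x\<bar> powr r + norm (g x) powr r)) \<in> borel_measurable lebesgue"
proof -
  define U where "U x = indicat_real \<Omega> x *\<^sub>R u x" for x
  define G where "G x = indicat_real \<Omega> x *\<^sub>R g x" for x
  have [measurable]: "U \<in> borel_measurable lebesgue" "G \<in> borel_measurable lebesgue"
    using assms by (auto simp: in_Lr_def U_def[abs_def] G_def[abs_def])
  have "(\<lambda>x. ennreal (norm (U x) powr r + norm (G x) powr r)) \<in> borel_measurable lebesgue"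
    by (intro measurable_compose[OF _ measurable_ennreal] borel_measurable_add powr_real_measurable
          borel_measurable_norm borel_measurable_const) simp_all
  moreover have "indicator \<Omega> x * ennreal (\<bar>u x\<bar> powr r + norm (g x) powr r) =
      ennreal (norm (U x) powr r + norm (G x) powr r)" for x
    using assms by (auto simp: U_def G_def split: split_indicator)
  ultimately show ?thesis by simp
qed

section \<open>From exponent p to exponent q on a shell\<close>

lemma shell_in_sets: "shell k \<in> sets lebesgue"
  by (rule fmeasurableD[OF lmeasurable_compact[OF compact_shell]])

lemma indicator_Int_mult: "indicator (\<Omega> \<inter> K) x * (c::ennreal) = indicator K x * (indicator \<Omega> x * c)"
  by (auto split: split_indicator)

lemma shell_int_measurable:
  assumes "in_Lr p \<Omega> u" "in_Lr p \<Omega> g" "0 < r"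
  shows "(\<lambda>x. indicator (\<Omega> \<inter> shell k) x * ennreal (\<bar>u x\<bar> powr r + norm (g x) powr r)) \<in> borel_measurable lebesgue"
  unfolding indicator_Int_mult
  by (intro borel_measurable_times_ennreal W1_int_measurable[OF assms] borel_measurable_indicator shell_in_sets)

text \<open>Split at the threshold l: below it t^q \<le> l^q, above it t^(q-p) \<le> l^(q-p) because
  q - p is not positive. The free l lets the constant part be made small first, before the
  p-energy.\<close>

lemma powr_le_powr_add:
  fixes t l :: real
  assumes "0 < l" "0 \<le> t" "0 \<le> q" "q \<le> p"
  shows "t powr q \<le> l powr q + l powr (q - p) * t powr p"
proof (cases "t \<le> l")
  case True
  then have "t powr q \<le> l powr q" using assms by (intro powr_mono2) auto
  then show ?thesis by (simp add: add_increasing2)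
next
  case False
  then have "t powr (q - p) \<le> l powr (q - p)" using assms by (intro powr_mono2') auto
  then have "t powr (q - p) * t powr p \<le> l powr (q - p) * t powr p" by (rule mult_right_mono) simp
  moreover have "t powr (q - p) * t powr p = t powr q" using False assms by (simp flip: powr_add)
  ultimately show ?thesis by (simp add: add_increasing)
qed

lemma W1_int_shell_small:
  fixes \<Omega> :: "'a::euclidean_space set"
  assumes "0 < q" "q \<le> p" "0 < \<delta>" "0 < c"
  obtains \<epsilon> where "0 < \<epsilon>"
    "\<And>u g. in_Lr p \<Omega> u \<Longrightarrow> in_Lr p \<Omega> g \<Longrightarrow> W1_int p \<Omega> u g < ennreal \<epsilon> \<Longrightarrow>
       ennreal c * W1_int q (\<Omega> \<inter> shell k) u g \<le> ennreal \<delta>"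
proof -
  define m where "m = measure lebesgue (shell k :: 'a set)"
  have m: "emeasure lebesgue (shell k :: 'a set) = ennreal m"
    unfolding m_def by (rule emeasure_eq_measure2[OF lmeasurable_compact[OF compact_shell]])
  have m0: "0 \<le> m" by (simp add: m_def)
  \<comment> \<open>Makes the contribution of the constant part at most \<delta>/2; m + 1 instead of
    m keeps the denominator positive.\<close>
  define l where "l = (\<delta> / (4 * c * (m + 1))) powr (1 / q)"
  have l0: "0 < l" using assms m0 by (simp add: l_def)
  have lq: "l powr q = \<delta> / (4 * c * (m + 1))"
    using assms m0 by (simp add: l_def powr_powr)
  \<comment> \<open>Chosen so that c * l^(q-p) * \<epsilon> is exactly \<delta>/2.\<close>
  define \<epsilon> where "\<epsilon> = \<delta> / (2 * c) * l powr (p - q)"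
  have e0: "0 < \<epsilon>" using assms l0 by (simp add: \<epsilon>_def)
  show ?thesis
  proof (rule that[OF e0])
    fix u :: "'a \<Rightarrow> real" and g :: "'a \<Rightarrow> 'a"
    assume ug: "in_Lr p \<Omega> u" "in_Lr p \<Omega> g" and small: "W1_int p \<Omega> u g < ennreal \<epsilon>"
    let ?Q = "\<lambda>r x. \<bar>u x\<bar> powr r + norm (g x) powr r"
    have "?Q q x \<le> 2 * l powr q + l powr (q - p) * ?Q p x" for x
      using powr_le_powr_add[OF l0, of "\<bar>u x\<bar>" q p] powr_le_powr_add[OF l0, of "norm (g x)" q p] assms
      by (simp add: algebra_simps)
    then have pt: "indicator (\<Omega> \<inter> shell k) x * ennreal (?Q q x) \<le>
        ennreal (2 * l powr q) * indicator (shell k) x + ennreal (l powr (q - p)) * (indicator \<Omega> x * ennreal (?Q p x))" for x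
      by (cases "x \<in> \<Omega> \<inter> shell k")
         (auto simp: ennreal_mult[symmetric] ennreal_plus[symmetric] simp del: ennreal_plus intro!: ennreal_leI)
    have m1: "(\<lambda>x. ennreal (2 * l powr q) * indicator (shell k :: 'a set) x) \<in> borel_measurable lebesgue"
      by (intro borel_measurable_times_ennreal borel_measurable_const borel_measurable_indicator
            shell_in_sets)
    have m2: "(\<lambda>x. ennreal (l powr (q - p)) * (indicator \<Omega> x * ennreal (?Q p x))) \<in> borel_measurable lebesgue"
      using assms
      by (intro borel_measurable_times_ennreal borel_measurable_const W1_int_measurable[OF ug]) simp
    have "W1_int q (\<Omega> \<inter> shell k) u g \<le> (\<integral>\<^sup>+ x. ennreal (2 * l powr q) * indicator (shell k) x +
        ennreal (l powr (q - p)) * (indicator \<Omega> x * ennreal (?Q p x)) \<partial>lebesgue)"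
      unfolding W1_int_def by (rule nn_integral_mono) (rule pt)
    also have "\<dots> = (\<integral>\<^sup>+ x. ennreal (2 * l powr q) * indicator (shell k :: 'a set) x \<partial>lebesgue) +
        (\<integral>\<^sup>+ x. ennreal (l powr (q - p)) * (indicator \<Omega> x * ennreal (?Q p x)) \<partial>lebesgue)"
      by (rule nn_integral_add[OF m1 m2])
    also have "\<dots> = ennreal (2 * l powr q) * ennreal m + ennreal (l powr (q - p)) * W1_int p \<Omega> u g"
    proof -
      have "0 < p" using assms by simp
      then show ?thesis
        unfolding W1_int_def nn_integral_cmult_indicator[OF shell_in_sets] m
        by (subst nn_integral_cmult[OF W1_int_measurable[OF ug]]) auto
    qed
    also have "\<dots> \<le> ennreal (2 * l powr q) * ennreal m + ennreal (l powr (q - p)) * ennreal \<epsilon>"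
      using small by (intro add_left_mono mult_left_mono) auto
    also have "\<dots> = ennreal (2 * l powr q * m + l powr (q - p) * \<epsilon>)"
      using m0 e0 by (simp add: ennreal_mult ennreal_plus)
    finally have "ennreal c * W1_int q (\<Omega> \<inter> shell k) u g \<le> ennreal c * ennreal (2 * l powr q * m + l powr (q - p) * \<epsilon>)"
      by (rule mult_left_mono) simp
    also have "\<dots> = ennreal (c * (2 * l powr q * m + l powr (q - p) * \<epsilon>))"
      using assms m0 e0 by (simp add: ennreal_mult)
    also have "\<dots> \<le> ennreal \<delta>"
    proof (rule ennreal_leI)
      have "l powr (q - p) * l powr (p - q) = 1" using l0 by (simp flip: powr_add)
      then have a: "l powr (q - p) * \<epsilon> = \<delta> / (2 * c)" by (simp add: \<epsilon>_def)
      have b: "c * (2 * l powr q * m) \<le> \<delta> / 2"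
      proof -
        have "c * (2 * l powr q * m) = \<delta> / 2 * (m / (m + 1))"
          using assms m0 by (simp add: lq divide_simps)
        also have "\<dots> \<le> \<delta> / 2 * 1"
          using assms m0 by (intro mult_left_mono) auto
        finally show ?thesis by simp
      qed
      show "c * (2 * l powr q * m + l powr (q - p) * \<epsilon>) \<le> \<delta>"
        using a b assms by (simp add: distrib_left)
    qed
    finally show "ennreal c * W1_int q (\<Omega> \<inter> shell k) u g \<le> ennreal \<delta>" .
  qed
qed

text \<open>The pieces are only required to lie in L^p on \<Omega>; their q-energy matters only on
  their own shell. Any weak gradient h k in L^p is allowed, which the main proof exploits in the
  tail of its approximation.\<close>

lemma glue_W1:
  fixes \<Omega> :: "'a::euclidean_space set"
  assumes \<Omega>: "open \<Omega>" and q: "1 \<le> q" and p: "1 \<le> p" and C: "\<And>k. 0 < C k"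
    "\<And>d h (x::'a). \<bar>glue d x\<bar> powr q + norm (glue_grad d h x) powr q \<le>
        (\<Sum>k | x \<in> shell k. C k * (\<bar>d k x\<bar> powr q + norm (h k x) powr q))"
    and d: "\<And>k. in_Lr p \<Omega> (d k)" and h: "\<And>k. in_Lr p \<Omega> (h k)"
    and wg: "\<And>k. weak_grad \<Omega> (d k) (h k)"
    and S: "(\<Sum>k. ennreal (C k) * W1_int q (\<Omega> \<inter> shell k) (d k) (h k)) \<le> ennreal e"
  shows "glue d \<in> W1 q \<Omega>" "W1_normr q \<Omega> (glue d) \<le> ennreal e"
proof -
  let ?Q = "\<lambda>k x. \<bar>d k x\<bar> powr q + norm (h k x) powr q"
  let ?T = "\<lambda>k x. ennreal (C k) * (indicator (\<Omega> \<inter> shell k) x * ennreal (?Q k x))"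
  have pt: "indicator \<Omega> x * ennreal (\<bar>glue d x\<bar> powr q + norm (glue_grad d h x) powr q) \<le> (\<Sum>k. ?T k x)" for x
  proof (cases "x \<in> \<Omega>")
    case True
    have "ennreal (\<bar>glue d x\<bar> powr q + norm (glue_grad d h x) powr q) \<le>
        ennreal (\<Sum>k | x \<in> shell k. C k * ?Q k x)"
      by (rule ennreal_leI) (rule C(2))
    also have "\<dots> = (\<Sum>k | x \<in> shell k. ?T k x)"
      using True C(1) by (subst sum_ennreal[symmetric])
        (auto simp: less_imp_le ennreal_mult intro!: sum.cong mult_nonneg_nonneg add_nonneg_nonneg)
    also have "\<dots> = (\<Sum>k. ?T k x)"
      by (rule suminf_finite[symmetric]) (auto simp: shell_indices)
    finally show ?thesis using True by simp
  qed simp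
  have Tm: "?T k \<in> borel_measurable lebesgue" for k
    using q by (intro borel_measurable_times_ennreal borel_measurable_const shell_int_measurable[OF d h]) simp
  have "W1_int q \<Omega> (glue d) (glue_grad d h) \<le> (\<integral>\<^sup>+ x. (\<Sum>k. ?T k x) \<partial>lebesgue)"
    unfolding W1_int_def by (rule nn_integral_mono) (rule pt)
  also have "\<dots> = (\<Sum>k. \<integral>\<^sup>+ x. ?T k x \<partial>lebesgue)"
    by (rule nn_integral_suminf) (rule Tm)
  also have "\<dots> = (\<Sum>k. ennreal (C k) * W1_int q (\<Omega> \<inter> shell k) (d k) (h k))"
    unfolding W1_int_def
    using q by (subst nn_integral_cmult[OF shell_int_measurable[OF d h]]) auto
  finally have bound: "W1_int q \<Omega> (glue d) (glue_grad d h) \<le> ennreal e" using S by simp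
  have Lr: "Lr_int q \<Omega> (glue d) \<le> W1_int q \<Omega> (glue d) (glue_grad d h)"
    "Lr_int q \<Omega> (glue_grad d h) \<le> W1_int q \<Omega> (glue d) (glue_grad d h)"
    unfolding Lr_int_def W1_int_def
    by (intro nn_integral_mono mult_left_mono ennreal_leI; simp)+
  have fin: "Lr_int q \<Omega> (glue d) < \<infinity>" "Lr_int q \<Omega> (glue_grad d h) < \<infinity>"
    using order.trans[OF Lr(1) bound] order.trans[OF Lr(2) bound]
    by (auto intro: le_less_trans)
  have dm: "(\<lambda>x. indicat_real \<Omega> x *\<^sub>R d k x) \<in> borel_measurable lebesgue"
    and hm: "(\<lambda>x. indicat_real \<Omega> x *\<^sub>R h k x) \<in> borel_measurable lebesgue" for k
    using d h by (auto simp: in_Lr_def)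
  have gm: "gradient (shell_bump k) \<in> borel_measurable (lebesgue :: 'a measure)" for k
    by (intro measurable_completion) (simp add: borel_measurable_continuous_onI continuous_gradient smooth_fun_shell_bump)
  \<comment> \<open>Each d k is known to be measurable only after restriction to \<Omega>, so the
    indicator is kept inside the series.\<close>
  have "(\<lambda>x. \<Sum>k. shell_bump k x * (indicat_real \<Omega> x *\<^sub>R d k x)) \<in> borel_measurable lebesgue"
    by (intro borel_measurable_suminf borel_measurable_times dm smooth_fun_measurable smooth_fun_shell_bump)
  moreover have "(\<Sum>k. shell_bump k x * (indicat_real \<Omega> x *\<^sub>R d k x)) = indicat_real \<Omega> x *\<^sub>R glue d x" for x
    by (cases "x \<in> \<Omega>") (simp_all add: glue_def)
  ultimately have "in_Lr q \<Omega> (glue d)" using fin by (simp add: in_Lr_def)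
  have "(\<lambda>x. \<Sum>k. shell_bump k x *\<^sub>R (indicat_real \<Omega> x *\<^sub>R h k x) +
      (indicat_real \<Omega> x *\<^sub>R d k x) *\<^sub>R gradient (shell_bump k) x) \<in> borel_measurable lebesgue"
    by (intro borel_measurable_suminf borel_measurable_add borel_measurable_scaleR dm hm gm
          smooth_fun_measurable smooth_fun_shell_bump)
  moreover have "(\<Sum>k. shell_bump k x *\<^sub>R (indicat_real \<Omega> x *\<^sub>R h k x) +
      (indicat_real \<Omega> x *\<^sub>R d k x) *\<^sub>R gradient (shell_bump k) x) = indicat_real \<Omega> x *\<^sub>R glue_grad d h x" for x
    by (cases "x \<in> \<Omega>") (simp_all add: glue_grad_def)
  ultimately have G: "in_Lr q \<Omega> (glue_grad d h)" using fin by (simp add: in_Lr_def)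
  have W: "weak_grad \<Omega> (glue d) (glue_grad d h)"
    by (rule weak_grad_glue[OF p d wg])
  show "glue d \<in> W1 q \<Omega>" by (rule W1I) fact+
  show "W1_normr q \<Omega> (glue d) \<le> ennreal e"
    using bound W1_normr_eq[OF \<Omega> q G W] by (simp add: W1_int_def)
qed

section \<open>Vanishing capacity\<close>

lemma suminf_half_powers_le:
  assumes "\<And>k. a k \<le> ennreal (e * (1/2) ^ Suc k)" "0 \<le> e"
  shows "(\<Sum>k. a k) \<le> ennreal e"
proof -
  have s: "(\<lambda>k. e * (1/2) ^ Suc k) sums (e * 1)"
    by (intro sums_mult power_half_series)
  have "(\<Sum>k. a k) \<le> (\<Sum>k. ennreal (e * (1/2) ^ Suc k))"
    by (intro suminf_le assms) auto
  also have "\<dots> = ennreal (\<Sum>k. e * (1/2) ^ Suc k)"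
    using s assms(2) by (intro suminf_ennreal2) (auto simp: sums_iff)
  also have "\<dots> = ennreal e"
    using s by (simp add: sums_iff)
  finally show ?thesis .
qed

lemma glue_diff: "glue (\<lambda>k x. v k x - u k x) x = glue v x - glue u x"
  by (simp add: glue_eq_sum[OF shell_indices(1) order_refl] right_diff_distrib sum_subtractf)

text \<open>The integer nearest to x . x supplies one bump of size at least 1. Admissibility asks
  only for a lower bound, so the bumps are never normalised to a partition of unity.\<close>

lemma glue_ge_1:
  assumes "\<And>k. shell_bump k x \<noteq> 0 \<Longrightarrow> 1 \<le> u k x"
  shows "1 \<le> glue u x"
proof -
  define j where "j = nat (round (x \<bullet> x))"
  have "\<bar>real j - x \<bullet> x\<bar> \<le> 1/2"
    using of_int_round_abs_le[of "x \<bullet> x"] round_mono[of 0 "x \<bullet> x"] by (simp add: j_def)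
  then have j: "1 \<le> shell_bump j x" "x \<in> shell j"
    by (auto simp: shell_bump_ge_1 shell_def)
  note j(1)
  also have "shell_bump j x \<le> (\<Sum>k | x \<in> shell k. shell_bump k x)"
    using j(2) by (intro member_le_sum) (auto simp: shell_indices shell_bump_nonneg)
  also have "\<dots> \<le> (\<Sum>k | x \<in> shell k. shell_bump k x * u k x)"
  proof (rule sum_mono)
    fix k
    show "shell_bump k x \<le> shell_bump k x * u k x"
      using assms[of k] shell_bump_nonneg[of k x]
      by (cases "shell_bump k x = 0") (auto simp: mult_le_cancel_left1)
  qed
  also have "\<dots> = glue u x"
    by (simp add: glue_eq_sum[OF shell_indices(1) order_refl])
  finally show ?thesis .
qed

lemma glue_finite:
  assumes "\<And>k. n < k \<Longrightarrow> w k = (\<lambda>x. 0)"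
  shows "glue w x = (\<Sum>k\<le>n. shell_bump k x * w k x)"
  unfolding glue_def by (rule suminf_finite) (auto simp: assms)

text \<open>Only finitely many bounded shells carry the function, which gives compact support.
  Membership in \<open>W1 q\<close> is an assumption here; the main proof gets it by writing the
  function as a sum of two glued functions.\<close>

lemma glue_Cc:
  assumes v: "\<And>k. k \<le> n \<Longrightarrow> v k \<in> Cc_closure_W1 p \<Omega>"
    and W: "glue (\<lambda>k. if k \<le> n then v k else (\<lambda>x. 0)) \<in> W1 q \<Omega>"
  shows "glue (\<lambda>k. if k \<le> n then v k else (\<lambda>x. 0)) \<in> Cc_closure_W1 q \<Omega>"
proof -
  let ?w = "\<lambda>k. if k \<le> n then v k else (\<lambda>x. 0)"
  have eq: "glue ?w = (\<lambda>x. \<Sum>k\<le>n. shell_bump k x * v k x)"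
    by (rule ext, subst glue_finite[of n]) auto
  have "continuous_on (closure \<Omega>) (glue ?w)"
    unfolding eq
  proof (intro continuous_on_sum continuous_on_mult)
    fix k assume "k \<in> {..n}"
    then show "continuous_on (closure \<Omega>) (v k)"
      using v[of k] by (simp add: Cc_closure_W1_def)
  qed (rule smooth_fun_continuous_on[OF smooth_fun_shell_bump])
  moreover have "compact (closure {x \<in> closure \<Omega>. glue ?w x \<noteq> 0})"
  proof -
    have "{x \<in> closure \<Omega>. glue ?w x \<noteq> 0} \<subseteq> (\<Union>k\<le>n. shell k)"
    proof
      fix x assume "x \<in> {x \<in> closure \<Omega>. glue ?w x \<noteq> 0}"
      then have "(\<Sum>k\<le>n. shell_bump k x * v k x) \<noteq> 0" by (simp add: eq)
      then obtain k where "k \<le> n" "shell_bump k x * v k x \<noteq> 0"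
        by (meson atMost_iff sum.neutral)
      then show "x \<in> (\<Union>k\<le>n. shell k)"
        using shell_bump_outside(1)[of x k] by auto
    qed
    moreover have "bounded (\<Union>k\<le>n. shell k :: 'a set)"
      by (intro bounded_UN) (auto simp: compact_imp_bounded compact_shell)
    ultimately show ?thesis by (meson bounded_subset compact_closure)
  qed
  ultimately show ?thesis using W by (simp add: Cc_closure_W1_def)
qed

theorem mainTheorem8:
  fixes \<Omega> :: "'a::euclidean_space set" and A :: "'a set" and p q :: real
  assumes "open \<Omega>" and "\<Omega> \<noteq> {}"
    and "1 < q" and "q \<le> p"
    and "A \<subseteq> closure \<Omega>"
    and "Cap p \<Omega> A = 0"
  shows "Cap q \<Omega> A = 0"
proof -
  have q: "0 \<le> q" "0 < q" "1 \<le> q" "1 \<le> p" "0 \<le> p" using assms by auto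
  obtain C :: "nat \<Rightarrow> real" where C: "\<And>k. 0 < C k"
    "\<And>d h (x::'a). \<bar>glue d x\<bar> powr q + norm (glue_grad d h x) powr q \<le>
        (\<Sum>k | x \<in> shell k. C k * (\<bar>d k x\<bar> powr q + norm (h k x) powr q))"
    by (rule glue_bound[OF q(1)]) (rule that)
  note glue_W1 = glue_W1[OF assms(1) q(3,4) C]
  have small: "\<exists>\<epsilon>>0. \<forall>u\<in>W1 p \<Omega>. W1_normr p \<Omega> u < ennreal \<epsilon> \<longrightarrow>
      ennreal (C k) * W1_int q (\<Omega> \<inter> shell k) u (wgrad p \<Omega> u) \<le> ennreal \<delta>" if pos: "0 < \<delta>" for \<delta> k
  proof -
    obtain \<epsilon> where "0 < \<epsilon>" and e:
      "\<And>u g. in_Lr p \<Omega> u \<Longrightarrow> in_Lr p \<Omega> g \<Longrightarrow> W1_int p \<Omega> u g < ennreal \<epsilon> \<Longrightarrow>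
        ennreal (C k) * W1_int q (\<Omega> \<inter> shell k) u g \<le> ennreal \<delta>"
      by (rule W1_int_shell_small[OF q(2) assms(4) pos C(1)]) (rule that)
    show ?thesis
    proof (intro exI[of _ \<epsilon>] conjI ballI impI)
      fix u assume u: "u \<in> W1 p \<Omega>" "W1_normr p \<Omega> u < ennreal \<epsilon>"
      then have "W1_int p \<Omega> u (wgrad p \<Omega> u) < ennreal \<epsilon>"
        by (simp add: W1_normr_def W1_int_def)
      then show "ennreal (C k) * W1_int q (\<Omega> \<inter> shell k) u (wgrad p \<Omega> u) \<le> ennreal \<delta>"
        by (rule e[OF W1_in_Lr[OF u(1)] wgrad_works(1)[OF u(1)]])
    qed fact
  qed
  have "Cap q \<Omega> A \<le> ennreal e" if e: "0 < e" "e \<le> 1" for e :: real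
  proof -
    \<comment> \<open>(1/4)^Suc k is (1/2)^Suc k squared: one factor makes the series over k
      converge, the other makes the tail beyond n as small as (1/2)^n.\<close>
    have "\<exists>u\<in>Y_set p \<Omega> A. ennreal (C k) * W1_int q (\<Omega> \<inter> shell k) u (wgrad p \<Omega> u)
        \<le> ennreal (e * (1/4) ^ Suc k)" for k
    proof -
      obtain \<epsilon> where \<epsilon>: "0 < \<epsilon>" "\<And>u. u \<in> W1 p \<Omega> \<Longrightarrow> W1_normr p \<Omega> u < ennreal \<epsilon> \<Longrightarrow>
          ennreal (C k) * W1_int q (\<Omega> \<inter> shell k) u (wgrad p \<Omega> u) \<le> ennreal (e * (1/4) ^ Suc k)"
        using small[of "e * (1/4) ^ Suc k" k] e by auto
      have "Cap p \<Omega> A < ennreal \<epsilon>" using assms(6) \<epsilon>(1) by simp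
      then obtain u where "u \<in> Y_set p \<Omega> A" "W1_normr p \<Omega> u < ennreal \<epsilon>"
        unfolding Cap_def by (auto simp: INF_less_iff)
      with \<epsilon>(2) show ?thesis by (auto simp: Y_set_def W1_tilde_def)
    qed
    then obtain u where uY: "\<And>k. u k \<in> Y_set p \<Omega> A" and uS:
      "\<And>k. ennreal (C k) * W1_int q (\<Omega> \<inter> shell k) (u k) (wgrad p \<Omega> (u k)) \<le> ennreal (e * (1/4) ^ Suc k)"
      by metis
    have uT: "u k \<in> W1_tilde p \<Omega>" and uW: "u k \<in> W1 p \<Omega>" for k
      using uY[of k] by (auto simp: Y_set_def W1_tilde_def)
    have "ennreal (e * (1/4) ^ Suc k) \<le> ennreal (e * (1/2) ^ Suc k)" for k
      using e by (intro ennreal_leI mult_left_mono power_mono) auto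
    then have "ennreal (C k) * W1_int q (\<Omega> \<inter> shell k) (u k) (wgrad p \<Omega> (u k)) \<le> ennreal (e * (1/2) ^ Suc k)" for k
      using uS order_trans by blast
    then have sum_u: "(\<Sum>k. ennreal (C k) * W1_int q (\<Omega> \<inter> shell k) (u k) (wgrad p \<Omega> (u k))) \<le> ennreal e"
      using e by (intro suminf_half_powers_le) auto
    have gu: "glue u \<in> W1 q \<Omega>" "W1_normr q \<Omega> (glue u) \<le> ennreal e"
      by (rule glue_W1[OF _ _ _ sum_u]; intro W1_in_Lr wgrad_works uW)+
    have "\<exists>v\<in>Cc_closure_W1 p \<Omega>. ennreal (C k) *
        W1_int q (\<Omega> \<inter> shell k) (\<lambda>x. v x - u k x) (wgrad p \<Omega> (\<lambda>x. v x - u k x))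
        \<le> ennreal ((1/2) ^ n * (1/2) ^ Suc k)" for n k
    proof -
      obtain \<epsilon> where \<epsilon>: "0 < \<epsilon>" "\<And>u. u \<in> W1 p \<Omega> \<Longrightarrow> W1_normr p \<Omega> u < ennreal \<epsilon> \<Longrightarrow>
          ennreal (C k) * W1_int q (\<Omega> \<inter> shell k) u (wgrad p \<Omega> u) \<le> ennreal ((1/2) ^ n * (1/2) ^ Suc k)"
        using small[of "(1/2) ^ n * (1/2) ^ Suc k" k] by auto
      obtain v where v: "\<And>m. v m \<in> Cc_closure_W1 p \<Omega>"
        "(\<lambda>m. W1_normr p \<Omega> (\<lambda>x. v m x - u k x)) \<longlonglongrightarrow> 0"
        using uT[of k] by (auto simp: W1_tilde_def)
      have "\<forall>\<^sub>F m in sequentially. W1_normr p \<Omega> (\<lambda>x. v m x - u k x) < ennreal \<epsilon>"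
        using \<epsilon>(1) by (intro order_tendstoD(2)[OF v(2)]) simp
      then obtain m where m: "W1_normr p \<Omega> (\<lambda>x. v m x - u k x) < ennreal \<epsilon>"
        by (auto simp: eventually_sequentially)
      have "(\<lambda>x. v m x - u k x) \<in> W1 p \<Omega>"
        using v(1)[of m] uW[of k] q by (intro W1_diff) (auto simp: Cc_closure_W1_def)
      from \<epsilon>(2)[OF this m] v(1)[of m] show ?thesis by blast
    qed
    then have "\<exists>v. \<forall>n k. v n k \<in> Cc_closure_W1 p \<Omega> \<and> ennreal (C k) *
        W1_int q (\<Omega> \<inter> shell k) (\<lambda>x. v n k x - u k x) (wgrad p \<Omega> (\<lambda>x. v n k x - u k x))
        \<le> ennreal ((1/2) ^ n * (1/2) ^ Suc k)"
      by (intro choice allI) (simp only: Bex_def)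
    then obtain v where vC: "\<And>n k. v n k \<in> Cc_closure_W1 p \<Omega>" and vS:
      "\<And>n k. ennreal (C k) *
        W1_int q (\<Omega> \<inter> shell k) (\<lambda>x. v n k x - u k x) (wgrad p \<Omega> (\<lambda>x. v n k x - u k x))
        \<le> ennreal ((1/2) ^ n * (1/2) ^ Suc k)"
      by blast
    \<comment> \<open>Cutting off after index n gives \<open>glue (w n)\<close> compact support. For
      k > n the error \<open>d n k\<close> is then -u k, with no approximant involved.\<close>
    define w where "w n k = (if k \<le> n then v n k else (\<lambda>x. 0))" for n k
    define d where "d n k = (\<lambda>x. w n k x - u k x)" for n k
    \<comment> \<open>\<open>wgrad\<close> is a choice, so the gradient chosen for -u k need not be
      the negative of the one chosen for u k. Taking the negative explicitly makes the energies
      coincide with those bounded in \<open>uS\<close>.\<close>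
    define h where "h n k = (if k \<le> n then wgrad p \<Omega> (d n k) else (\<lambda>x. - wgrad p \<Omega> (u k) x))" for n k
    have d_le: "d n k = (\<lambda>x. v n k x - u k x)" "h n k = wgrad p \<Omega> (d n k)" if "k \<le> n" for n k
      using that by (auto simp: d_def w_def h_def)
    have d_gt: "d n k = (\<lambda>x. - u k x)" "h n k = (\<lambda>x. - wgrad p \<Omega> (u k) x)" if "\<not> k \<le> n" for n k
      using that by (auto simp: d_def w_def h_def)
    have dW: "d n k \<in> W1 p \<Omega>" for n k
    proof (cases "k \<le> n")
      case True
      have "v n k \<in> W1 p \<Omega>" using vC[of n k] by (simp add: Cc_closure_W1_def)
      then show ?thesis unfolding d_le(1)[OF True] by (rule W1_diff[OF _ uW q(5)])
    next
      case False
      show ?thesis unfolding d_gt(1)[OF False] by (rule W1_minus[OF uW])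
    qed
    have hL: "in_Lr p \<Omega> (h n k)" and hG: "weak_grad \<Omega> (d n k) (h n k)" for n k
    proof (atomize (full), cases "k \<le> n")
      case True
      show "in_Lr p \<Omega> (h n k) \<and> weak_grad \<Omega> (d n k) (h n k)"
        unfolding d_le(2)[OF True] using wgrad_works[OF dW] by simp
    next
      case False
      show "in_Lr p \<Omega> (h n k) \<and> weak_grad \<Omega> (d n k) (h n k)"
        unfolding d_gt[OF False] using wgrad_works[OF uW] by (simp add: in_Lr_minus weak_grad_minus)
    qed
    have "ennreal (C k) * W1_int q (\<Omega> \<inter> shell k) (d n k) (h n k) \<le> ennreal ((1/2) ^ n * (1/2) ^ Suc k)" for n k
    proof (cases "k \<le> n")
      case True
      then show ?thesis using vS[of k n] by (simp only: d_le)
    next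
      case False
      \<comment> \<open>In the tail one of the two spare factors (1/2)^Suc k is traded for (1/2)^n;
        the restriction e \<le> 1 absorbs the factor e.\<close>
      have "(1/2::real) ^ Suc k \<le> (1/2) ^ n" using False by (intro power_decreasing) auto
      then have "e * (1/4::real) ^ Suc k \<le> 1 * ((1/2) ^ n * (1/2) ^ Suc k)"
        using e mult_right_mono[of "(1/2::real) ^ Suc k" "(1/2) ^ n" "(1/2) ^ Suc k"]
        by (intro mult_mono) (simp_all flip: power_mult_distrib)
      then have "ennreal (e * (1/4) ^ Suc k) \<le> ennreal ((1/2) ^ n * (1/2) ^ Suc k)"
        by (intro ennreal_leI) simp
      with uS[of k] have "ennreal (C k) * W1_int q (\<Omega> \<inter> shell k) (u k) (wgrad p \<Omega> (u k)) \<le>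
          ennreal ((1/2) ^ n * (1/2) ^ Suc k)"
        by (rule order_trans)
      then show ?thesis
        unfolding d_gt[OF False] by (simp only: W1_int_def abs_minus_cancel norm_minus_cancel)
    qed
    then have sum_d: "(\<Sum>k. ennreal (C k) * W1_int q (\<Omega> \<inter> shell k) (d n k) (h n k)) \<le> ennreal ((1/2) ^ n)" for n
      by (intro suminf_half_powers_le) auto
    have gd: "glue (d n) \<in> W1 q \<Omega>" "W1_normr q \<Omega> (glue (d n)) \<le> ennreal ((1/2) ^ n)" for n
      by (rule glue_W1[OF _ _ _ sum_d]; intro W1_in_Lr dW hL hG)+
    have glue_d: "glue (d n) = (\<lambda>x. glue (w n) x - glue u x)" for n
      unfolding d_def by (rule ext) (rule glue_diff)
    have gw: "glue (w n) \<in> Cc_closure_W1 q \<Omega>" for n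
    proof -
      \<comment> \<open>\<open>glue (w n)\<close> inherits membership from the error and the limit,
        both of which have controlled q-energy.\<close>
      have "(\<lambda>x. glue (d n) x + glue u x) \<in> W1 q \<Omega>"
        by (rule W1_add[OF gd(1) gu(1) q(1)])
      then have "glue (w n) \<in> W1 q \<Omega>" by (simp add: glue_d)
      then show ?thesis
        unfolding w_def by (rule glue_Cc[rotated]) (rule vC)
    qed
    have "(\<lambda>n. W1_normr q \<Omega> (\<lambda>x. glue (w n) x - glue u x)) \<longlonglongrightarrow> 0"
    proof (rule tendsto_sandwich)
      show "\<forall>\<^sub>F n in sequentially. 0 \<le> W1_normr q \<Omega> (\<lambda>x. glue (w n) x - glue u x)" by simp
      show "\<forall>\<^sub>F n in sequentially. W1_normr q \<Omega> (\<lambda>x. glue (w n) x - glue u x) \<le> ennreal ((1/2) ^ n)"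
        using gd(2) by (simp add: glue_d)
      show "(\<lambda>n. ennreal ((1/2) ^ n)) \<longlonglongrightarrow> 0"
        unfolding ennreal_0[symmetric] by (intro tendsto_ennrealI LIMSEQ_realpow_zero) auto
    qed simp
    then have tilde: "glue u \<in> W1_tilde q \<Omega>"
      unfolding W1_tilde_def using gu(1) gw by (auto intro!: exI[of _ "\<lambda>n. glue (w n)"])
    have "\<exists>U. openin (top_of_set (closure \<Omega>)) U \<and> A \<subseteq> U \<and>
        (AE x in lebesgue. x \<in> U \<inter> \<Omega> \<longrightarrow> 1 \<le> u k x)" for k
      using uY[of k] by (simp add: Y_set_def)
    then obtain U where U: "\<And>k. openin (top_of_set (closure \<Omega>)) (U k)" "\<And>k. A \<subseteq> U k"
      "\<And>k. AE x in lebesgue. x \<in> U k \<inter> \<Omega> \<longrightarrow> 1 \<le> u k x"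
      by metis
    \<comment> \<open>The intersection of all U k need not be relatively open. Where x . x < m,
      every nonzero bump has index at most m, so the finite intersection up to m suffices on that
      ball.\<close>
    define V where "V = (\<Union>m. {x. x \<bullet> x < real m} \<inter> (\<Inter>k\<in>{..m}. U k))"
    have V: "openin (top_of_set (closure \<Omega>)) V"
      unfolding V_def
    proof (intro openin_Union; clarify)
      fix m
      have "openin (top_of_set (closure \<Omega>)) (\<Inter>k\<in>{..m}. U k)"
        by (intro openin_INT2 U(1)) auto
      moreover have "open {x::'a. x \<bullet> x < real m}"
        by (intro open_Collect_less continuous_intros)
      ultimately show "openin (top_of_set (closure \<Omega>)) ({x. x \<bullet> x < real m} \<inter> (\<Inter>k\<in>{..m}. U k))"
        by (metis Int_commute openin_Int_open)
    qed
    have AV: "A \<subseteq> V"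
    proof
      fix x assume "x \<in> A"
      moreover obtain m :: nat where "x \<bullet> x < real m" using reals_Archimedean2 by blast
      ultimately show "x \<in> V" using U(2) by (auto simp: V_def)
    qed
    have "AE x in lebesgue. \<forall>k. x \<in> U k \<inter> \<Omega> \<longrightarrow> 1 \<le> u k x"
      using U(3) by (simp add: AE_all_countable)
    then have "AE x in lebesgue. x \<in> V \<inter> \<Omega> \<longrightarrow> 1 \<le> glue u x"
    proof eventually_elim
      case (elim x)
      show ?case
      proof
        assume x: "x \<in> V \<inter> \<Omega>"
        then obtain m where m: "x \<bullet> x < real m" "\<And>k. k \<le> m \<Longrightarrow> x \<in> U k"
          by (auto simp: V_def)
        show "1 \<le> glue u x"
        proof (rule glue_ge_1)
          fix k assume "shell_bump k x \<noteq> 0"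
          then have "k \<le> m" using m(1) shell_bump_neq_0D[of k x] by linarith
          then show "1 \<le> u k x" using elim m(2) x by blast
        qed
      qed
    qed
    with tilde V AV have "glue u \<in> Y_set q \<Omega> A"
      unfolding Y_set_def by blast
    then show ?thesis
      unfolding Cap_def using gu(2) by (meson INF_lower order_trans)
  qed
  \<comment> \<open>The bound was proved only for 0 < e \<le> 1, so it is used along the sequence
    (1/2)^n.\<close>
  then have "Cap q \<Omega> A \<le> ennreal ((1/2) ^ n)" for n by (simp add: power_le_one)
  moreover have "(\<lambda>n. ennreal ((1/2) ^ n)) \<longlonglongrightarrow> ennreal 0"
    by (intro tendsto_ennrealI LIMSEQ_realpow_zero) auto
  ultimately have "Cap q \<Omega> A \<le> ennreal 0"
    by (intro LIMSEQ_le_const[of "\<lambda>n. ennreal ((1/2) ^ n)"]) auto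
  then show ?thesis by simp
qed

end
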